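(* Consider a stochastic linear bandit in dimension $d>1$ with (possibly infinite) arm set $\mathcal{A}$, horizon $T$, feature vectors and parameter of Euclidean norm at most $1$ and rewards in $[0,1]$, and run RandUCB for linear bandits with regularization parameter $\lambda>0$ and sampling random variable $Z$. Let $$c_1=\sqrt{\lambda}+\frac12\sqrt{d\ln\left(T+\frac{T^2}{d\lambda}\right)},\qquad c_3:=2d\ln\left(1+\frac{T}{d\lambda}\right).$$ For any $c_2>c_1$, the regret of RandUCB is bounded by $$(c_1+c_2)\left(1+\frac{2}{\mathbf{P}(Z>c_1)-\mathbf{P}(|Z|>c_2)}\right)\sqrt{c_3T}+T\,\mathbf{P}(|Z|>c_2)+1 .$$
   Context: Linear bandit: each arm $i\in\mathcal{A}$ has a known feature vector $x_i\in\mathbb{R}^d$ with $\|x_i\|\le1$; there is an unknown $\theta^\star\in\mathbb{R}^d$ with $\|\theta^\star\|\le1$. In each round $t=1,\dots,T$ the learner pulls an arm $i_t\in\mathcal{A}$ (based on the past and its own randomness) and receives a reward $Y_t\in[0,1]$ drawn from the reward distribution of arm $i_t$, with $\mathbf{E}[Y_t\mid i_t=i]=\langle x_i,\theta^\star\rangle$. Arm $1$ is an optimal arm, i.e. it maximizes $\langle x_i,\theta^\star\rangle$. The regret is $R(T)=\sum_{t=1}^T\mathbf{E}[\langle x_1-x_{i_t},\theta^\star\rangle]$. Notation: $X_t:=x_{i_t}$, $M_t:=\lambda I_d+\sum_{\ell=1}^{t-1}X_\ell X_\ell^{\mathsf T}$, $\hat\theta_t:=M_t^{-1}\sum_{\ell=1}^{t-1}Y_\ell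 X_\ell$, and $\|x\|_N:=\sqrt{x^{\mathsf T}Nx}$ for positive definite $N$. RandUCB for linear bandits: let $Z$ be a given real-valued random variable and $Z_1,\dots,Z_T$ i.i.d. copies of $Z$, with $Z_t$ independent of the history before round $t$. In round $t$ the algorithm pulls $$i_t=\arg\max_{i\in\mathcal{A}}\left\{\langle\hat\theta_t,x_i\rangle+Z_t\|x_i\|_{M_t^{-1}}\right\}.$$
   Formalization: The added condition P(Z>c_1) > P(|Z|>c_2) is required: if the two are equal the bound is undefined, and if Z = -(c_2+1) is constant the bound is negative for large c_2 although the regret is nonnegative. *)

theory Defs
  imports "HOL-Probability.Probability"
begin

text \<open>
  The arm set is the carrier of a measurable space \<open>\<A>\<close>, so that it may be infinite (for a countable
  arm set take the count space).  The vector \<open>x a\<close> is the feature vector of arm \<open>a\<close> and \<open>\<nu> a\<close> its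
  reward distribution; \<open>\<nu>\<close> is a probability kernel.
\<close>

locale linear_bandit =
  fixes \<A> :: "'a measure"
    and x :: "'a \<Rightarrow> real ^ 'd"
    and \<theta> :: "real ^ 'd"
    and \<nu> :: "'a \<Rightarrow> real measure"
  assumes features_measurable: "x \<in> borel_measurable \<A>"
    and features_norm: "a \<in> space \<A> \<Longrightarrow> norm (x a) \<le> 1"
    and parameter_norm: "norm \<theta> \<le> 1"
    and reward_kernel: "\<nu> \<in> \<A> \<rightarrow>\<^sub>M prob_algebra borel"
    and reward_range: "a \<in> space \<A> \<Longrightarrow> AE y in \<nu> a. 0 \<le> y \<and> y \<le> 1"
    and reward_mean: "a \<in> space \<A> \<Longrightarrow> (\<integral>y. y \<partial>\<nu> a) = x a \<bullet> \<theta>"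

definition optimal_arm :: "'a measure \<Rightarrow> ('a \<Rightarrow> real ^ 'd) \<Rightarrow> real ^ 'd \<Rightarrow> 'a \<Rightarrow> bool" where
  "optimal_arm \<A> x \<theta> a \<longleftrightarrow> is_arg_max (\<lambda>b. x b \<bullet> \<theta>) (\<lambda>b. b \<in> space \<A>) a"

text \<open>
  The history before round \<open>t\<close> consists of the arms pulled and the rewards received in rounds
  \<open>1, \<dots>, t - 1\<close>.
\<close>

definition history :: "(nat \<Rightarrow> 'w \<Rightarrow> 'a) \<Rightarrow> (nat \<Rightarrow> 'w \<Rightarrow> real) \<Rightarrow> nat \<Rightarrow> 'w \<Rightarrow> nat \<Rightarrow> 'a \<times> real" where
  "history I Y t \<omega> = (\<lambda>s\<in>{1..<t}. (I s \<omega>, Y s \<omega>))"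

definition history_space :: "'a measure \<Rightarrow> nat \<Rightarrow> (nat \<Rightarrow> 'a \<times> real) measure" where
  "history_space \<A> t = (\<Pi>\<^sub>M s\<in>{1..<t}. \<A> \<Otimes>\<^sub>M borel)"

text \<open>The sigma-algebra generated by the history before round \<open>t\<close> and the arm pulled in round \<open>t\<close>.\<close>

definition pull_algebra ::
    "'w measure \<Rightarrow> 'a measure \<Rightarrow> (nat \<Rightarrow> 'w \<Rightarrow> 'a) \<Rightarrow> (nat \<Rightarrow> 'w \<Rightarrow> real) \<Rightarrow> nat \<Rightarrow> 'w measure" where
  "pull_algebra M \<A> I Y t =
     vimage_algebra (space M) (\<lambda>\<omega>. (history I Y t \<omega>, I t \<omega>)) (history_space \<A> t \<Otimes>\<^sub>M \<A>)"

text \<open>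
  A run of \<open>T\<close> rounds: \<open>I t\<close> is the arm pulled and \<open>Y t\<close> the reward received in round \<open>t\<close>.
  Given the history and the pulled arm, the reward has the distribution of that arm.  In
  particular a randomised choice of the arm cannot anticipate its reward.
\<close>

locale bandit_run = linear_bandit \<A> x \<theta> \<nu> + prob_space M
  for M :: "'w measure"
    and \<A> :: "'a measure"
    and x :: "'a \<Rightarrow> real ^ 'd"
    and \<theta> :: "real ^ 'd"
    and \<nu> :: "'a \<Rightarrow> real measure" +
  fixes T :: nat
    and I :: "nat \<Rightarrow> 'w \<Rightarrow> 'a"
    and Y :: "nat \<Rightarrow> 'w \<Rightarrow> real"
  assumes pull_measurable: "t \<in> {1..T} \<Longrightarrow> I t \<in> M \<rightarrow>\<^sub>M \<A>"
    and reward_measurable: "t \<in> {1..T} \<Longrightarrow> Y t \<in> borel_measurable M"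
    and reward_law: "t \<in> {1..T} \<Longrightarrow> B \<in> sets borel \<Longrightarrow>
      AE \<omega> in M. real_cond_exp M (pull_algebra M \<A> I Y t) (\<lambda>\<omega>'. indicator B (Y t \<omega>')) \<omega>
        = measure (\<nu> (I t \<omega>)) B"

definition regret ::
    "'w measure \<Rightarrow> ('a \<Rightarrow> real ^ 'd) \<Rightarrow> real ^ 'd \<Rightarrow> 'a \<Rightarrow> (nat \<Rightarrow> 'w \<Rightarrow> 'a) \<Rightarrow> nat \<Rightarrow> real" where
  "regret M x \<theta> a\<^sub>1 I T = (\<Sum>t=1..T. \<integral>\<omega>. (x a\<^sub>1 - x (I t \<omega>)) \<bullet> \<theta> \<partial>M)"

text \<open>
  In the next definitions \<open>X s\<close> and \<open>Y s\<close> are the realised feature vector and reward of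
  round \<open>s\<close>; \<open>\<chi> i j. X s $ i * X s $ j\<close> is the outer product of \<open>X s\<close> with itself.
\<close>

definition design_matrix :: "real \<Rightarrow> (nat \<Rightarrow> real ^ 'd) \<Rightarrow> nat \<Rightarrow> real ^ 'd ^ 'd" where
  "design_matrix lam X t = mat lam + (\<Sum>s\<in>{1..<t}. \<chi> i j. X s $ i * X s $ j)"

definition ridge_estimate ::
    "real \<Rightarrow> (nat \<Rightarrow> real ^ 'd) \<Rightarrow> (nat \<Rightarrow> real) \<Rightarrow> nat \<Rightarrow> real ^ 'd" where
  "ridge_estimate lam X Y t = matrix_inv (design_matrix lam X t) *v (\<Sum>s\<in>{1..<t}. Y s *\<^sub>R X s)"

definition matrix_norm :: "real ^ 'd ^ 'd \<Rightarrow> real ^ 'd \<Rightarrow> real" where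
  "matrix_norm N v = sqrt (v \<bullet> (N *v v))"

definition rand_ucb_index ::
    "real \<Rightarrow> (nat \<Rightarrow> real ^ 'd) \<Rightarrow> (nat \<Rightarrow> real) \<Rightarrow> nat \<Rightarrow> real \<Rightarrow> real ^ 'd \<Rightarrow> real" where
  "rand_ucb_index lam X Y t z v =
     ridge_estimate lam X Y t \<bullet> v + z * matrix_norm (matrix_inv (design_matrix lam X t)) v"

text \<open>
  The random variable \<open>Z\<^sub>0\<close> lives on its own probability space \<open>N\<close>, and \<open>Z 1, \<dots>, Z T\<close> are its
  i.i.d. copies on the space of the run.  Ties in the argmax may be broken arbitrarily, subject to
  the independence of \<open>Z t\<close> and the law of the rewards.
\<close>

locale rand_ucb_run = bandit_run M \<A> x \<theta> \<nu> T I Y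
  for M :: "'w measure"
    and \<A> :: "'a measure"
    and x :: "'a \<Rightarrow> real ^ 'd"
    and \<theta> :: "real ^ 'd"
    and \<nu> :: "'a \<Rightarrow> real measure"
    and T :: nat
    and I :: "nat \<Rightarrow> 'w \<Rightarrow> 'a"
    and Y :: "nat \<Rightarrow> 'w \<Rightarrow> real" +
  fixes lam :: real
    and N :: "'z measure"
    and Z\<^sub>0 :: "'z \<Rightarrow> real"
    and Z :: "nat \<Rightarrow> 'w \<Rightarrow> real"
  assumes sampling_space: "prob_space N"
    and sampling_measurable: "Z\<^sub>0 \<in> borel_measurable N"
    and copies_independent: "indep_vars (\<lambda>_. borel) Z {1..T}"
    and copies_distribution: "t \<in> {1..T} \<Longrightarrow> distr M borel (Z t) = distr N borel Z\<^sub>0"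
    and copies_fresh: "t \<in> {1..T} \<Longrightarrow>
      indep_set (sets (vimage_algebra (space M) (Z t) borel))
        (sets (vimage_algebra (space M) (history I Y t) (history_space \<A> t)))"
    and pull_rule: "t \<in> {1..T} \<Longrightarrow> AE \<omega> in M.
      is_arg_max (\<lambda>a. rand_ucb_index lam (\<lambda>s. x (I s \<omega>)) (\<lambda>s. Y s \<omega>) t (Z t \<omega>) (x a))
        (\<lambda>a. a \<in> space \<A>) (I t \<omega>)"

end

theory Submission
  imports Defs
begin

text \<open>
  The regret of a single round is bounded as follows.  Call an arm unsaturated if its gap is less than
  \<open>c\<^sub>1 + c\<^sub>2\<close> times its width \<open>\<parallel>x\<^sub>i\<parallel>\<close> in the norm of the inverse design matrix.  On the event that the
  ridge estimate is accurate up to \<open>c\<^sub>1\<close> widths and \<open>\<bar>Z\<^sub>t\<bar> \<le> c\<^sub>2\<close>, the gap of the pulled arm is at most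
  \<open>c\<^sub>1 + c\<^sub>2\<close> times its own width plus twice that of any unsaturated arm, and if moreover
  \<open>Z\<^sub>t > c\<^sub>1\<close>, then the pulled arm is itself unsaturated.  As \<open>Z\<^sub>t\<close> is independent of the history, the
  smallest width of an unsaturated arm is in expectation at most that of the pulled arm divided by
  \<open>P(Z > c\<^sub>1) - P(\<bar>Z\<bar> > c\<^sub>2)\<close>.  The widths of the pulled arms are summed with the matrix determinant
  lemma, \<open>min 1 q \<le> 2 ln (1 + q)\<close> and \<open>det A \<le> (tr A / d)\<^sup>d\<close>.

  The accuracy of the estimate follows from Markov's inequality applied to
  \<open>exp (2 \<parallel>S\<^sub>t\<parallel>\<^sup>2) / sqrt (det M\<^sub>t / \<lambda>\<^sup>d)\<close>, where the norm is that of
  \<open>M\<^sub>t\<^sup>-\<^sup>1\<close> and \<open>S\<^sub>t\<close> is the sum of the noise terms times the features.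
  Its expectation does not increase with \<open>t\<close>: by the Sherman--Morrison formula this is a statement
  about a single scalar noise variable, and the square of that variable in the exponent is
  linearised by a one-dimensional Gaussian before applying Hoeffding's lemma.  The failure
  probability is at most \<open>1 / T\<close> in each round, so no maximal inequality is needed.
\<close>

subsection \<open>Positive definite matrices\<close>

definition posdef :: "real ^ 'n ^ 'n \<Rightarrow> bool" where
  "posdef A \<longleftrightarrow> transpose A = A \<and> (\<forall>u. u \<noteq> 0 \<longrightarrow> 0 < u \<bullet> (A *v u))"

definition outer :: "real ^ 'n \<Rightarrow> real ^ 'n \<Rightarrow> real ^ 'n ^ 'n" where
  "outer u v = (\<chi> i j. u $ i * v $ j)"

lemma outer_vector_mult: "outer u v *v w = (v \<bullet> w) *\<^sub>R u"
proof -
  have "(outer u v *v w) $ i = ((v \<bullet> w) *\<^sub>R u) $ i" for i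
    by (simp add: outer_def matrix_vector_mult_def inner_vec_def sum_distrib_left mult.assoc mult.commute[of _ "u $ i"])
  then show ?thesis
    by (simp add: vec_eq_iff)
qed

lemma posdef_symD: "posdef A \<Longrightarrow> u \<bullet> (A *v w) = (A *v u) \<bullet> w"
  by (metis dot_lmul_matrix posdef_def vector_transpose_matrix)

lemma posdef_nonneg: "posdef A \<Longrightarrow> 0 \<le> u \<bullet> (A *v u)"
  by (cases "u = 0") (auto simp: posdef_def less_imp_le)

lemma posdef_Cauchy_Schwarz:
  assumes "posdef A"
  shows "(u \<bullet> (A *v v))\<^sup>2 \<le> (u \<bullet> (A *v u)) * (v \<bullet> (A *v v))"
proof (cases "v = 0")
  case False
  define t where "t = (u \<bullet> (A *v v)) / (v \<bullet> (A *v v))"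
  have pos: "0 < v \<bullet> (A *v v)"
    using assms False by (auto simp: posdef_def)
  have "0 \<le> (u - t *\<^sub>R v) \<bullet> (A *v (u - t *\<^sub>R v))"
    by (rule posdef_nonneg[OF assms])
  also have "\<dots> = u \<bullet> (A *v u) - 2 * t * (u \<bullet> (A *v v)) + t\<^sup>2 * (v \<bullet> (A *v v))"
    using posdef_symD[OF assms, of v u]
    by (simp add: matrix_vector_mult_diff_distrib matrix_vector_mult_scaleR algebra_simps
        inner_commute power2_eq_square)
  also have "\<dots> = u \<bullet> (A *v u) - (u \<bullet> (A *v v))\<^sup>2 / (v \<bullet> (A *v v))"
    using pos by (simp add: t_def field_simps power2_eq_square)
  finally show ?thesis
    using pos by (simp add: field_simps)
qed simp

lemma posdef_det_nonzero:
  assumes "posdef A"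
  shows "det A \<noteq> 0"
proof -
  have "inj ((*v) A)"
  proof (rule injI)
    fix u w assume "A *v u = A *v w"
    then have "A *v (u - w) = 0"
      by (simp add: matrix_vector_mult_diff_distrib)
    then show "u = w"
      using assms by (metis eq_iff_diff_eq_0 inner_zero_right less_irrefl posdef_def)
  qed
  then show ?thesis
    using det_nz_iff_inj[of "(*v) A"] by simp
qed

lemma posdef_inverse:
  assumes "posdef A"
  shows "A *v (matrix_inv A *v u) = u" "matrix_inv A *v (A *v u) = u"
proof -
  have "invertible A"
    using posdef_det_nonzero[OF assms] by (simp add: invertible_det_nz)
  then have "A ** matrix_inv A = mat 1 \<and> matrix_inv A ** A = mat 1"
    unfolding invertible_def matrix_inv_def by (rule someI_ex)
  then show "A *v (matrix_inv A *v u) = u" "matrix_inv A *v (A *v u) = u"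
    by (simp_all add: matrix_vector_mul_assoc)
qed

lemma posdef_matrix_inv:
  assumes "posdef A"
  shows "posdef (matrix_inv A)"
proof -
  have sym: "u \<bullet> (matrix_inv A *v w) = (matrix_inv A *v u) \<bullet> w" for u w
    using posdef_symD[OF assms, of "matrix_inv A *v u" "matrix_inv A *v w"] posdef_inverse[OF assms]
    by simp
  have "transpose (matrix_inv A) *v u = matrix_inv A *v u" for u
    by (rule vector_eq_rdot[THEN iffD1]) (metis dot_lmul_matrix inner_commute sym transpose_matrix_vector)
  then have "transpose (matrix_inv A) = matrix_inv A"
    by (simp add: matrix_eq)
  moreover have "0 < u \<bullet> (matrix_inv A *v u)" if "u \<noteq> 0" for u
  proof -
    have "matrix_inv A *v u \<noteq> 0"
      using posdef_inverse(1)[OF assms, of u] that by auto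
    then show ?thesis
      using assms posdef_inverse(1)[OF assms, of u] unfolding posdef_def
      by (metis inner_commute)
  qed
  ultimately show ?thesis
    by (simp add: posdef_def)
qed

lemma det_unit_column:
  fixes B C :: "real ^ 'n ^ 'n"
  assumes B: "\<And>i. i \<noteq> k \<Longrightarrow> B $ i $ k = 0" and C: "\<And>i. i \<noteq> k \<Longrightarrow> C $ i $ k = 0"
    and "B $ k $ k = C $ k $ k"
    and eq: "\<And>i j. i \<noteq> k \<Longrightarrow> j \<noteq> k \<Longrightarrow> B $ i $ j = C $ i $ j"
  shows "det B = det C"
  unfolding det_def
proof (rule sum.cong[OF refl])
  fix p assume "p \<in> {p. p permutes (UNIV :: 'n set)}"
  then have p: "p permutes UNIV" by simp
  have "(\<Prod>i\<in>UNIV. B $ i $ p i) = (\<Prod>i\<in>UNIV. C $ i $ p i)"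
  proof (cases "p k = k")
    case True
    then have "p i \<noteq> k" if "i \<noteq> k" for i
      using that permutes_inj[OF p] by (metis injD)
    then show ?thesis
      using True assms(3) eq by (intro prod.cong) metis+
  next
    case False
    obtain i where i: "p i = k"
      using permutes_surj[OF p] by (metis surjD)
    with False have "i \<noteq> k" by auto
    then have "B $ i $ p i = 0" "C $ i $ p i = 0"
      using B C i by auto
    then have "(\<Prod>i\<in>UNIV. B $ i $ p i) = 0" "(\<Prod>i\<in>UNIV. C $ i $ p i) = 0"
      by (intro prod_zero[OF finite] bexI[of _ i]; simp)+
    then show ?thesis by (simp only:)
  qed
  then show "of_int (sign p) * (\<Prod>i\<in>UNIV. B $ i $ p i) = of_int (sign p) * (\<Prod>i\<in>UNIV. C $ i $ p i)"
    by simp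
qed


text \<open>
  The indices in \<open>J\<close> are eliminated by overwriting their rows and columns with those of the
  identity, which keeps the type of the matrix.
\<close>

definition eliminate :: "'n set \<Rightarrow> real ^ 'n ^ 'n \<Rightarrow> real ^ 'n ^ 'n" where
  "eliminate J A = (\<chi> i j. if i \<in> J \<or> j \<in> J then (if i = j then 1 else 0) else A $ i $ j)"

lemma eliminate_quadratic_form:
  fixes A :: "real ^ 'n ^ 'n" and u :: "real ^ 'n" and J :: "'n set"
  defines "v \<equiv> (\<chi> i. if i \<in> J then 0 else u $ i)"
  shows "u \<bullet> (eliminate J A *v u) = (\<Sum>i\<in>UNIV. if i \<in> J then (u $ i)\<^sup>2 else 0) + v \<bullet> (A *v v)"
proof -
  have "u $ i * (eliminate J A *v u) $ i = (if i \<in> J then (u $ i)\<^sup>2 else 0) + v $ i * (A *v v) $ i" for i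
  proof (cases "i \<in> J")
    case True
    have "(eliminate J A *v u) $ i = (\<Sum>j\<in>UNIV. if i = j then u $ j else 0)"
      unfolding matrix_vector_mult_def vec_lambda_beta
      by (rule sum.cong) (use True in \<open>simp_all add: eliminate_def\<close>)
    then have "(eliminate J A *v u) $ i = u $ i" by simp
    moreover have "v $ i = 0"
      using True by (simp add: v_def)
    ultimately show ?thesis
      using True by (simp add: power2_eq_square)
  next
    case False
    have "(eliminate J A *v u) $ i = (A *v v) $ i"
      unfolding matrix_vector_mult_def vec_lambda_beta
      by (rule sum.cong) (use False in \<open>auto simp: eliminate_def v_def\<close>)
    moreover have "v $ i = u $ i"
      using False by (simp add: v_def)
    ultimately show ?thesis
      using False by simp
  qed
  then show ?thesis
    by (simp add: inner_vec_def sum.distrib)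
qed

lemma posdef_eliminate:
  fixes A :: "real ^ 'n ^ 'n"
  assumes A: "posdef A"
  shows "posdef (eliminate J A)"
proof -
  have sym: "A $ i $ j = A $ j $ i" for i j
  proof -
    have "transpose A $ j $ i = A $ j $ i"
      using A unfolding posdef_def by simp
    then show ?thesis
      unfolding transpose_def vec_lambda_beta .
  qed
  have "0 < u \<bullet> (eliminate J A *v u)" if u: "u \<noteq> 0" for u
  proof -
    define v where "v = (\<chi> i. if i \<in> J then 0 else u $ i)"
    define D where "D = (\<Sum>i\<in>UNIV. if i \<in> J then (u $ i)\<^sup>2 else 0)"
    have eq: "u \<bullet> (eliminate J A *v u) = D + v \<bullet> (A *v v)"
      unfolding v_def D_def by (rule eliminate_quadratic_form)
    have D: "0 \<le> D"
      unfolding D_def by (intro sum_nonneg) auto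
    show ?thesis
    proof (cases "v = 0")
      case True
      obtain i where i: "u $ i \<noteq> 0"
        using u by (auto simp: vec_eq_iff)
      have "v $ i = 0"
        using True by simp
      then have "i \<in> J"
        using i by (simp add: v_def split: if_splits)
      have "0 < D"
        unfolding D_def by (rule sum_pos2[of _ i]) (use i \<open>i \<in> J\<close> in auto)
      with True eq show ?thesis by simp
    next
      case False
      then have "0 < v \<bullet> (A *v v)"
        using A by (simp add: posdef_def)
      with D eq show ?thesis by simp
    qed
  qed
  moreover have "transpose (eliminate J A) $ i $ j = eliminate J A $ i $ j" for i j
    unfolding transpose_def eliminate_def vec_lambda_beta by (rule if_cong) (use sym in auto)
  then have "transpose (eliminate J A) = eliminate J A"
    unfolding vec_eq_iff by blast
  ultimately show ?thesis
    unfolding posdef_def by blast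
qed


lemma det_eliminate_insert:
  fixes A :: "real ^ 'n ^ 'n"
  assumes A: "posdef A" and k: "k \<notin> J" and pos: "0 < det (eliminate (insert k J) A)"
  shows "0 < det (eliminate J A)" "det (eliminate J A) \<le> A $ k $ k * det (eliminate (insert k J) A)"
proof -
  let ?E = "eliminate J A"
  define e :: "real ^ 'n" where "e = axis k 1"
  define z where "z = matrix_inv ?E *v e"
  have E: "posdef ?E"
    by (rule posdef_eliminate[OF A])
  have Ez: "?E *v z = e"
    unfolding z_def by (rule posdef_inverse[OF E])
  have "det (eliminate (insert k J) A) = det (\<chi> i j. if j = k then (?E *v z) $ i else ?E $ i $ j)"
    unfolding Ez by (rule det_unit_column[of k]) (use k in \<open>auto simp: eliminate_def e_def axis_def\<close>)
  then have det: "det (eliminate (insert k J) A) = z $ k * det ?E"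
    by (simp add: cramer_lemma)
  have zk: "z \<bullet> (?E *v z) = z $ k"
    by (simp add: Ez e_def inner_axis)
  have "z $ k \<noteq> 0"
    using pos det by auto
  then have "0 < z $ k"
    using posdef_nonneg[OF E, of z] zk by linarith
  then show "0 < det ?E"
    using pos det by (simp add: zero_less_mult_iff)
  have "(e \<bullet> (?E *v z))\<^sup>2 \<le> (e \<bullet> (?E *v e)) * (z \<bullet> (?E *v z))"
    by (rule posdef_Cauchy_Schwarz[OF E])
  also have "e \<bullet> (?E *v e) = A $ k $ k"
    using k by (simp add: e_def inner_axis' matrix_vector_mul_component inner_axis eliminate_def)
  finally have "1 \<le> A $ k $ k * z $ k"
    by (simp add: zk) (simp add: Ez e_def inner_axis)
  then have "det ?E * 1 \<le> det ?E * (A $ k $ k * z $ k)"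
    using \<open>0 < det ?E\<close> by (intro mult_left_mono) auto
  then show "det ?E \<le> A $ k $ k * det (eliminate (insert k J) A)"
    by (simp add: det algebra_simps)
qed


lemma posdef_diagonal_pos: "posdef A \<Longrightarrow> 0 < A $ k $ k"
  unfolding posdef_def
  by (drule conjunct2, drule spec[of _ "axis k 1"])
    (simp add: inner_axis' matrix_vector_mul_component inner_axis axis_eq_0_iff)

lemma Hadamard_inequality:
  fixes A :: "real ^ 'n ^ 'n"
  assumes "posdef A"
  shows "0 < det A" "det A \<le> (\<Prod>k\<in>UNIV. A $ k $ k)"
proof -
  have "0 < det (eliminate (UNIV - K) A) \<and> det (eliminate (UNIV - K) A) \<le> (\<Prod>k\<in>K. A $ k $ k)" for K
  proof (induction K rule: infinite_finite_induct)
    case empty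
    have "eliminate UNIV A = mat 1"
      by (simp add: eliminate_def mat_def)
    then show ?case by simp
  next
    case (insert k K)
    have ins: "insert k (UNIV - insert k K) = UNIV - K"
      using insert.hyps by auto
    have "0 < det (eliminate (UNIV - insert k K) A)"
      and le: "det (eliminate (UNIV - insert k K) A) \<le> A $ k $ k * det (eliminate (UNIV - K) A)"
      using det_eliminate_insert[OF assms, of k "UNIV - insert k K"] insert.IH
      unfolding ins by auto
    moreover have "A $ k $ k * det (eliminate (UNIV - K) A) \<le> A $ k $ k * (\<Prod>k\<in>K. A $ k $ k)"
      using insert.IH posdef_diagonal_pos[OF assms, of k] by (intro mult_left_mono) auto
    ultimately show ?case
      using insert.hyps by (simp add: prod.insert)
  qed simp
  from this[of UNIV] show "0 < det A" "det A \<le> (\<Prod>k\<in>UNIV. A $ k $ k)"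
    by (simp_all add: eliminate_def)
qed

lemma posdef_ln_det_le:
  fixes A :: "real ^ 'n ^ 'n"
  assumes A: "posdef A" and c: "0 < c" "trace A \<le> real CARD('n) * c"
  shows "ln (det A) \<le> real CARD('n) * ln c"
proof -
  have pos: "0 < A $ k $ k" for k
    by (rule posdef_diagonal_pos[OF A])
  have "ln (det A) \<le> ln (\<Prod>k\<in>UNIV. A $ k $ k)"
    using Hadamard_inequality[OF A] by simp
  also have "\<dots> = (\<Sum>k\<in>UNIV. ln (A $ k $ k))"
    using pos by (intro ln_prod) (auto simp: less_le)
  also have "\<dots> \<le> (\<Sum>k\<in>UNIV. ln c + (A $ k $ k / c - 1))"
  proof (rule sum_mono)
    fix k
    have "ln (A $ k $ k) = ln c + ln (A $ k $ k / c)"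
      using pos[of k] c by (simp add: ln_div)
    then show "ln (A $ k $ k) \<le> ln c + (A $ k $ k / c - 1)"
      using ln_le_minus_one[of "A $ k $ k / c"] pos[of k] c by simp
  qed
  also have "\<dots> = real CARD('n) * ln c + (trace A / c - real CARD('n))"
    by (simp add: sum.distrib sum_subtractf trace_def sum_divide_distrib)
  also have "\<dots> \<le> real CARD('n) * ln c"
    using c by (simp add: field_simps)
  finally show ?thesis .
qed


lemma det_replace_row_identity:
  fixes v :: "real ^ 'n"
  shows "det (\<chi> i. if i = k then v else axis i 1) = v $ k"
proof -
  have "transpose (\<chi> i. if i = k then v else axis i 1) =
      (\<chi> i j. if j = k then (mat 1 *v v) $ i else (mat 1 :: real ^ 'n ^ 'n) $ i $ j)"
    unfolding matrix_vector_mul_lid by (auto simp: transpose_def vec_eq_iff mat_def axis_def)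
  then have "det (transpose (\<chi> i. if i = k then v else axis i 1)) = v $ k * det (mat 1 :: real ^ 'n ^ 'n)"
    by (simp only: cramer_lemma)
  then show ?thesis
    by simp
qed

lemma det_replace_row_identity_plus:
  fixes u v :: "real ^ 'n"
  assumes "k \<notin> J"
  shows "det (\<chi> i. if i = k then v else if i \<in> J then axis i 1 + u $ i *s v else axis i 1) = v $ k"
  using assms
proof (induction J rule: infinite_finite_induct)
  case (insert j J)
  let ?A = "\<chi> i. if i = k then v else if i \<in> J then axis i 1 + u $ i *s v else axis i 1"
  have "det (\<chi> i. if i = j then row j ?A + u $ j *s row k ?A else row i ?A) = det ?A"
    using insert.prems by (intro det_row_operation) auto
  also have "(\<chi> i. if i = j then row j ?A + u $ j *s row k ?A else row i ?A) =
     (\<chi> i. if i = k then v else if i \<in> insert j J then axis i 1 + u $ i *s v else axis i 1)"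
    using insert by (auto simp: vec_eq_iff row_def)
  finally show ?case
    using insert by simp
qed (simp_all add: det_replace_row_identity cong: if_cong)

lemma det_identity_plus_outer:
  fixes u v :: "real ^ 'n"
  shows "det (mat 1 + outer u v) = 1 + u \<bullet> v"
proof -
  have J: "det (\<chi> i. if i \<in> J then axis i 1 + u $ i *s v else axis i 1) = 1 + (\<Sum>i\<in>J. u $ i * v $ i)" for J
  proof (induction J rule: infinite_finite_induct)
    case empty
    have "(\<chi> i. axis i 1) = (mat 1 :: real ^ 'n ^ 'n)"
      by (auto simp: vec_eq_iff mat_def axis_def)
    then show ?case by simp
  next
    case (insert k J)
    let ?c = "\<lambda>i. if i \<in> J then axis i 1 + u $ i *s v else axis i 1"
    have "det (\<chi> i. if i \<in> insert k J then axis i 1 + u $ i *s v else axis i 1) =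
        det (\<chi> i. if i = k then axis i 1 + u $ i *s v else ?c i)"
      using insert by (intro arg_cong[of _ _ det]) (auto simp: vec_eq_iff)
    also have "\<dots> = det (\<chi> i. if i = k then axis i 1 else ?c i) + det (\<chi> i. if i = k then u $ i *s v else ?c i)"
      by (rule det_row_add)
    also have "(\<chi> i. if i = k then axis i 1 else ?c i) = (\<chi> i. ?c i)"
      using insert by (auto simp: vec_eq_iff)
    also have "(\<chi> i. if i = k then u $ i *s v else ?c i) = (\<chi> i. if i = k then u $ k *s v else ?c i)"
      by (auto simp: vec_eq_iff)
    also have "det \<dots> = u $ k * det (\<chi> i. if i = k then v else ?c i)"
      by (rule det_row_mul)
    finally show ?case
      using insert det_replace_row_identity_plus[of k J v u] by simp
  qed simp
  have eq: "(\<chi> i. if i \<in> UNIV then axis i 1 + u $ i *s v else axis i 1) = mat 1 + outer u v"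
    by (auto simp: vec_eq_iff mat_def axis_def outer_def)
  show ?thesis
    using J[of UNIV] unfolding eq inner_vec_def inner_real_def .
qed


lemma matrix_mult_outer: "A ** outer u v = outer (A *v u) v"
  by (simp add: outer_def matrix_matrix_mult_def matrix_vector_mult_def vec_eq_iff
      sum_distrib_right mult.assoc)

lemma det_rank_one_update:
  assumes "posdef A"
  shows "det (A + outer v v) = det A * (1 + v \<bullet> (matrix_inv A *v v))"
proof -
  have "A + outer v v = A ** (mat 1 + outer (matrix_inv A *v v) v)"
    by (simp add: matrix_add_ldistrib matrix_mult_outer posdef_inverse[OF assms])
  then show ?thesis
    by (simp add: det_mul det_identity_plus_outer inner_commute)
qed

lemma posdef_rank_one_update:
  assumes "posdef A"
  shows "posdef (A + outer v v)"
proof -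
  have "transpose (A + outer v v) = transpose A + outer v v"
    by (simp add: transpose_def outer_def vec_eq_iff mult.commute)
  moreover have "u \<bullet> ((A + outer v v) *v u) = u \<bullet> (A *v u) + (v \<bullet> u)\<^sup>2" for u
    by (simp add: matrix_vector_mult_add_rdistrib outer_vector_mult inner_add_right
        power2_eq_square inner_commute)
  ultimately show ?thesis
    using assms by (auto simp: posdef_def add_pos_nonneg)
qed


lemma Sherman_Morrison:
  fixes v :: "real ^ 'n"
  assumes A: "posdef A"
  defines "q \<equiv> v \<bullet> (matrix_inv A *v v)"
  shows "matrix_inv (A + outer v v) *v u =
    matrix_inv A *v u - ((v \<bullet> (matrix_inv A *v u)) / (1 + q)) *\<^sub>R (matrix_inv A *v v)"
    (is "_ = ?w")
proof -
  have "0 \<le> q"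
    unfolding q_def by (rule posdef_nonneg[OF posdef_matrix_inv[OF A]])
  then have "1 + q \<noteq> 0" by simp
  define r where "r = (v \<bullet> (matrix_inv A *v u)) / (1 + q)"
  have r: "v \<bullet> (matrix_inv A *v u) = r + r * q"
  proof -
    have "r * (1 + q) = v \<bullet> (matrix_inv A *v u)"
      unfolding r_def using \<open>1 + q \<noteq> 0\<close> by (rule nonzero_eq_divide_eq[THEN iffD1, OF _ refl])
    then show ?thesis
      by (simp add: distrib_left)
  qed
  have "(A + outer v v) *v (matrix_inv A *v u - r *\<^sub>R (matrix_inv A *v v)) =
      u - r *\<^sub>R v + (v \<bullet> (matrix_inv A *v u) - r * q) *\<^sub>R v"
    by (simp add: matrix_vector_mult_add_rdistrib outer_vector_mult matrix_vector_mult_diff_distrib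
        matrix_vector_mult_scaleR inner_diff_right q_def posdef_inverse[OF A] scaleR_add_right
        scaleR_left_diff_distrib)
  then have "(A + outer v v) *v ?w = u"
    unfolding r_def[symmetric] by (simp add: r)
  then show ?thesis
    by (metis A posdef_inverse(2) posdef_rank_one_update)
qed

lemma rank_one_update_quadratic_form:
  fixes s v :: "real ^ 'n"
  assumes A: "posdef A"
  defines "q \<equiv> v \<bullet> (matrix_inv A *v v)" and "b \<equiv> v \<bullet> (matrix_inv A *v s)"
  shows "(s + c *\<^sub>R v) \<bullet> (matrix_inv (A + outer v v) *v (s + c *\<^sub>R v)) =
    s \<bullet> (matrix_inv A *v s) + (2 * c * b + c\<^sup>2 * q - b\<^sup>2) / (1 + q)"
proof -
  have "0 \<le> q"
    unfolding q_def by (rule posdef_nonneg[OF posdef_matrix_inv[OF A]])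
  moreover have "s \<bullet> (matrix_inv A *v v) = b"
    using posdef_symD[OF posdef_matrix_inv[OF A], of s v] by (simp add: b_def inner_commute)
  ultimately show ?thesis
    unfolding Sherman_Morrison[OF A]
    by (simp add: matrix_vector_right_distrib matrix_vector_mult_scaleR inner_diff_right
        inner_add_left inner_add_right q_def[symmetric] b_def[symmetric] field_simps power2_eq_square)
qed

subsection \<open>The one-step exponential inequality\<close>

lemma normal_density_exp_quadratic:
  fixes b c q u :: real
  assumes q: "0 < q"
  shows "normal_density b (sqrt q / 2) u * exp (4 * u * c - 2 * u\<^sup>2) =
    exp (2 * (2 * c * b + c\<^sup>2 * q - b\<^sup>2) / (1 + q)) / sqrt (1 + q) *
      normal_density ((b + c * q) / (1 + q)) (sqrt (q / (1 + q)) / 2) u"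
proof -
  define r where "r = 1 + q"
  have r: "0 < r" "q = r - 1"
    using q by (simp_all add: r_def)
  have v: "(sqrt q / 2)\<^sup>2 = q / 4" "(sqrt (q / r) / 2)\<^sup>2 = q / (4 * r)"
    using q r(1) by (simp_all add: power_divide)
  have "- (2 * (u - b)\<^sup>2 / q) + (4 * u * c - 2 * u\<^sup>2) =
      2 * (2 * c * b + c\<^sup>2 * q - b\<^sup>2) / r - 2 * r * (u - (b + c * q) / r)\<^sup>2 / q"
  proof -
    have "(- (2 * (u - b)\<^sup>2 / q) + (4 * u * c - 2 * u\<^sup>2)) * (q * r) =
       - 2 * (u - b)\<^sup>2 * r + (4 * u * c - 2 * u\<^sup>2) * (q * r)"
    proof -
      have "2 * (u - b)\<^sup>2 / q * (q * r) = 2 * (u - b)\<^sup>2 * r"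
        using q by simp
      then show ?thesis
        by (simp only: distrib_right mult_minus_left)
    qed
    also have "\<dots> = 2 * (2 * c * b + c\<^sup>2 * q - b\<^sup>2) * q - 2 * (r * u - (b + c * q))\<^sup>2"
      unfolding r_def by (simp add: power2_eq_square algebra_simps)
    also have "(r * u - (b + c * q))\<^sup>2 = (r * (u - (b + c * q) / r))\<^sup>2"
      using r(1) by (simp add: right_diff_distrib)
    also have "2 * (2 * c * b + c\<^sup>2 * q - b\<^sup>2) * q - 2 * \<dots> =
      (2 * (2 * c * b + c\<^sup>2 * q - b\<^sup>2) / r - 2 * r * (u - (b + c * q) / r)\<^sup>2 / q) * (q * r)"
    proof -
      have "2 * E * q - 2 * (r * w)\<^sup>2 = (2 * E / r - 2 * r * w\<^sup>2 / q) * (q * r)" for E w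
      proof -
        have "2 * E / r * (q * r) = 2 * E * q" "2 * r * w\<^sup>2 / q * (q * r) = 2 * (r * w)\<^sup>2"
          using q r(1) by (simp_all add: power_mult_distrib power2_eq_square)
        then show ?thesis
          by (simp only: left_diff_distrib)
      qed
      then show ?thesis .
    qed
    finally show ?thesis
      using q r(1) by simp
  qed
  moreover have "- (u - b)\<^sup>2 / (2 * (q / 4)) = - (2 * (u - b)\<^sup>2 / q)"
    "- (u - (b + c * q) / r)\<^sup>2 / (2 * (q / (4 * r))) = - (2 * r * (u - (b + c * q) / r)\<^sup>2 / q)"
    by simp_all
  ultimately have "exp (- (u - b)\<^sup>2 / (2 * (q / 4))) * exp (4 * u * c - 2 * u\<^sup>2) =
      exp (2 * (2 * c * b + c\<^sup>2 * q - b\<^sup>2) / r) * exp (- (u - (b + c * q) / r)\<^sup>2 / (2 * (q / (4 * r))))"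
    by (simp only: exp_add[symmetric] diff_conv_add_uminus)
  moreover have "1 / sqrt (2 * pi * (q / 4)) = 1 / sqrt r * (1 / sqrt (2 * pi * (q / (4 * r))))"
  proof -
    have "2 * pi * (q / 4) = r * (2 * pi * (q / (4 * r)))"
      using r(1) by simp
    then have "sqrt (2 * pi * (q / 4)) = sqrt r * sqrt (2 * pi * (q / (4 * r)))"
      by (metis real_sqrt_mult)
    then show ?thesis
      by (simp only: divide_divide_eq_left times_divide_times_eq mult_1)
  qed
  ultimately show ?thesis
    unfolding normal_density_def v r_def[symmetric] by (simp add: mult_ac)
qed

lemma nn_integral_normal_density: "0 < \<sigma> \<Longrightarrow> (\<integral>\<^sup>+u. ennreal (normal_density \<mu> \<sigma> u) \<partial>lborel) = 1"
  using nn_integral_eq_integral[of lborel "normal_density \<mu> \<sigma>"] by (simp add: normal_density_nonneg)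

lemma nn_integral_normal_density_exp_quadratic:
  fixes b c q :: real
  assumes q: "0 < q"
  shows "(\<integral>\<^sup>+u. ennreal (normal_density b (sqrt q / 2) u) * ennreal (exp (4 * u * c - 2 * u\<^sup>2)) \<partial>lborel) =
    ennreal (exp (2 * (2 * c * b + c\<^sup>2 * q - b\<^sup>2) / (1 + q)) / sqrt (1 + q))"
proof -
  let ?C = "exp (2 * (2 * c * b + c\<^sup>2 * q - b\<^sup>2) / (1 + q)) / sqrt (1 + q)"
  let ?n = "normal_density ((b + c * q) / (1 + q)) (sqrt (q / (1 + q)) / 2)"
  have C: "0 \<le> ?C"
    using q by simp
  have "(\<integral>\<^sup>+u. ennreal (normal_density b (sqrt q / 2) u) * ennreal (exp (4 * u * c - 2 * u\<^sup>2)) \<partial>lborel) =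
      (\<integral>\<^sup>+u. ennreal ?C * ennreal (?n u) \<partial>lborel)"
    using normal_density_exp_quadratic[OF q, of b _ c]
    by (intro nn_integral_cong) (simp only: ennreal_mult'[symmetric] exp_ge_zero normal_density_nonneg C)
  also have "\<dots> = ennreal ?C"
    using q by (simp add: nn_integral_cmult nn_integral_normal_density)
  finally show ?thesis .
qed

lemma Hoeffding_unit_interval:
  fixes s :: real
  assumes P: "prob_space P" "sets P = sets borel" and AE: "AE y in P. 0 \<le> y \<and> y \<le> 1"
  shows "(\<integral>\<^sup>+y. ennreal (exp (s * (y - (\<integral>y. y \<partial>P)))) \<partial>P) \<le> ennreal (exp (s\<^sup>2 / 8))"
proof -
  interpret prob_space P by (rule P)
  have id: "(\<lambda>y. y) \<in> borel_measurable P" "(\<lambda>y. - y) \<in> borel_measurable P"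
    using P(2) by (auto simp: measurable_cong_sets[OF P(2) refl])
  consider "s = 0" | "0 < s" | "0 < - s" by linarith
  then show ?thesis
  proof cases
    case 1
    then show ?thesis by (simp add: emeasure_space_1)
  next
    case 2
    interpret interval_bounded_random_variable P "\<lambda>y. y" 0 1
      using AE id by unfold_locales auto
    show ?thesis
      using Hoeffdings_lemma_nn_integral[OF 2] by simp
  next
    case 3
    interpret interval_bounded_random_variable P "\<lambda>y. - y" "- 1" 0
      using AE id by unfold_locales auto
    show ?thesis
      using Hoeffdings_lemma_nn_integral[OF 3] by (simp add: algebra_simps)
  qed
qed

lemma nn_integral_exp_quadratic_le:
  fixes b q :: real
  assumes P: "prob_space P" "sets P = sets borel" and AE: "AE y in P. 0 \<le> y \<and> y \<le> 1"
    and q: "0 \<le> q"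
  defines "\<mu> \<equiv> \<integral>y. y \<partial>P"
  shows "(\<integral>\<^sup>+y. ennreal (exp (2 * (2 * (y - \<mu>) * b + (y - \<mu>)\<^sup>2 * q - b\<^sup>2) / (1 + q)) / sqrt (1 + q)) \<partial>P) \<le> 1"
proof -
  interpret prob_space P by (rule P)
  note [measurable_cong] = P(2)
  have *: "(\<integral>\<^sup>+y. ennreal (exp (4 * u * (y - \<mu>) - 2 * u\<^sup>2)) \<partial>P) \<le> 1" for u
  proof -
    have "(\<integral>\<^sup>+y. ennreal (exp (4 * u * (y - \<mu>) - 2 * u\<^sup>2)) \<partial>P) =
        (\<integral>\<^sup>+y. ennreal (exp (- 2 * u\<^sup>2)) * ennreal (exp ((4 * u) * (y - \<mu>))) \<partial>P)"
      by (intro nn_integral_cong) (simp add: ennreal_mult'[symmetric] exp_add[symmetric])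
    also have "\<dots> = ennreal (exp (- 2 * u\<^sup>2)) * (\<integral>\<^sup>+y. ennreal (exp ((4 * u) * (y - \<mu>))) \<partial>P)"
      by (intro nn_integral_cmult) measurable
    also have "\<dots> \<le> ennreal (exp (- 2 * u\<^sup>2)) * ennreal (exp ((4 * u)\<^sup>2 / 8))"
      unfolding \<mu>_def by (intro mult_left_mono Hoeffding_unit_interval P AE) simp
    also have "\<dots> = 1"
      by (simp add: ennreal_mult'[symmetric] exp_add[symmetric] power_mult_distrib)
    finally show ?thesis .
  qed
  show ?thesis
  proof (cases "q = 0")
    case True
    then show ?thesis
      using *[of b] by (simp add: algebra_simps)
  next
    case False
    with q have q: "0 < q" by simp
    interpret S: pair_sigma_finite lborel P
      by (rule pair_sigma_finite.intro) (rule lborel.sigma_finite_measure_axioms sigma_finite_measure_axioms)+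
    let ?f = "\<lambda>u y. ennreal (normal_density b (sqrt q / 2) u) * ennreal (exp (4 * u * (y - \<mu>) - 2 * u\<^sup>2))"
    have "(\<integral>\<^sup>+y. ennreal (exp (2 * (2 * (y - \<mu>) * b + (y - \<mu>)\<^sup>2 * q - b\<^sup>2) / (1 + q)) / sqrt (1 + q)) \<partial>P) =
        (\<integral>\<^sup>+y. \<integral>\<^sup>+u. ?f u y \<partial>lborel \<partial>P)"
      by (simp only: nn_integral_normal_density_exp_quadratic[OF q])
    also have "\<dots> = (\<integral>\<^sup>+u. \<integral>\<^sup>+y. ?f u y \<partial>P \<partial>lborel)"
      by (rule S.Fubini') (simp add: normal_density_def, measurable)
    also have "\<dots> = (\<integral>\<^sup>+u. ennreal (normal_density b (sqrt q / 2) u) *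
        (\<integral>\<^sup>+y. ennreal (exp (4 * u * (y - \<mu>) - 2 * u\<^sup>2)) \<partial>P) \<partial>lborel)"
      by (intro nn_integral_cong nn_integral_cmult) measurable
    also have "\<dots> \<le> (\<integral>\<^sup>+u. ennreal (normal_density b (sqrt q / 2) u) * 1 \<partial>lborel)"
      by (intro nn_integral_mono mult_left_mono *) simp
    also have "\<dots> = 1"
      using q by (simp add: nn_integral_normal_density)
    finally show ?thesis .
  qed
qed

subsection \<open>Conditional laws given by a kernel\<close>

lemma (in prob_space) nn_integral_conditional_kernel:
  assumes G[measurable]: "G \<in> M \<rightarrow>\<^sub>M R" and Y[measurable]: "Y \<in> M \<rightarrow>\<^sub>M L"
    and K[measurable]: "K \<in> R \<rightarrow>\<^sub>M prob_algebra L"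
    and law: "\<And>B. B \<in> sets L \<Longrightarrow>
      AE \<omega> in M. real_cond_exp M (vimage_algebra (space M) G R) (\<lambda>\<omega>'. indicator B (Y \<omega>')) \<omega>
        = measure (K (G \<omega>)) B"
    and F[measurable]: "F \<in> borel_measurable (R \<Otimes>\<^sub>M L)"
  shows "(\<integral>\<^sup>+\<omega>. F (G \<omega>, Y \<omega>) \<partial>M) = (\<integral>\<^sup>+\<omega>. \<integral>\<^sup>+y. F (G \<omega>, y) \<partial>K (G \<omega>) \<partial>M)"
proof -
  let ?A = "vimage_algebra (space M) G R"
  have K': "(\<lambda>\<omega>. distr (K (G \<omega>)) (R \<Otimes>\<^sub>M L) (\<lambda>y. (G \<omega>, y))) \<in> M \<rightarrow>\<^sub>M prob_algebra (R \<Otimes>\<^sub>M L)"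
    by (rule measurable_distr_prob_space2[where M = L]) measurable
  note K'_sub = measurable_prob_algebraD[OF K']
  define P where "P = distr M (R \<Otimes>\<^sub>M L) (\<lambda>\<omega>. (G \<omega>, Y \<omega>))"
  define Q where "Q = M \<bind> (\<lambda>\<omega>. distr (K (G \<omega>)) (R \<Otimes>\<^sub>M L) (\<lambda>y. (G \<omega>, y)))"
  have sets_K: "sets (K (G \<omega>)) = sets L" and prob_K: "prob_space (K (G \<omega>))" if "\<omega> \<in> space M" for \<omega>
    using measurable_space[OF K measurable_space[OF G that]] by (auto simp: space_prob_algebra)
  have sets_Q: "sets Q = sets (R \<Otimes>\<^sub>M L)"
    unfolding Q_def by (rule sets_bind[OF _ not_empty]) simp
  have sub: "finite_measure_subalgebra M ?A"
    unfolding finite_measure_subalgebra_def finite_measure_subalgebra_axioms_def subalgebra_def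
    using sets_image_in_sets[OF refl G] finite_measure_axioms by auto
  interpret sub: finite_measure_subalgebra M ?A by (rule sub)
  have "P = Q"
  proof (rule measure_eqI_generator_eq[OF Int_stable_pair_measure_generator[of R L]])
    show "{a \<times> b |a b. a \<in> sets R \<and> b \<in> sets L} \<subseteq> Pow (space R \<times> space L)"
      by (rule pair_measure_closed)
    show "sets P = sigma_sets (space R \<times> space L) {a \<times> b |a b. a \<in> sets R \<and> b \<in> sets L}"
      "sets Q = sigma_sets (space R \<times> space L) {a \<times> b |a b. a \<in> sets R \<and> b \<in> sets L}"
      unfolding P_def sets_distr sets_Q by (rule sets_pair_measure)+
    have "space R \<times> space L \<in> {a \<times> b |a b. a \<in> sets R \<and> b \<in> sets L}"
      by (rule CollectI) (rule exI[of _ "space R"], rule exI[of _ "space L"], simp)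
    then show "range (\<lambda>_::nat. space R \<times> space L) \<subseteq> {a \<times> b |a b. a \<in> sets R \<and> b \<in> sets L}"
      "(\<Union>i::nat. space R \<times> space L) = space R \<times> space L"
      by (simp_all only: image_constant_conv) simp_all
    have "prob_space P"
      unfolding P_def by (rule prob_space_distr) measurable
    then show "emeasure P (space R \<times> space L) \<noteq> \<infinity>" for i :: nat
      unfolding infinity_ennreal_def by (rule finite_measure.emeasure_finite[OF prob_space.finite_measure])
  next
    fix X assume "X \<in> {a \<times> b |a b. a \<in> sets R \<and> b \<in> sets L}"
    then obtain a b where X: "X = a \<times> b" and a[measurable]: "a \<in> sets R" and b[measurable]: "b \<in> sets L"
      by auto
    let ?a = "G -` a \<inter> space M"
    have a': "?a \<in> sets ?A"
      by (rule in_vimage_algebra[OF a])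
    have int_b: "integrable M (\<lambda>\<omega>. indicator b (Y \<omega>) :: real)"
      by (rule integrable_const_bound[where B = 1]) simp_all
    have mK: "(\<lambda>\<omega>. measure (K (G \<omega>)) b) \<in> borel_measurable M"
      by measurable
    have int_K: "integrable M (\<lambda>\<omega>. indicator ?a \<omega> * measure (K (G \<omega>)) b)"
    proof (rule integrable_const_bound[where B = 1])
      show "AE \<omega> in M. norm (indicator ?a \<omega> * measure (K (G \<omega>)) b) \<le> 1"
        by (rule AE_I2) (auto simp: indicator_def intro!: prob_space.prob_le_1 prob_K)
      show "(\<lambda>\<omega>. indicator ?a \<omega> * measure (K (G \<omega>)) b) \<in> borel_measurable M"
        by (intro borel_measurable_times borel_measurable_indicator mK measurable_sets[OF G a])
    qed
    have "(\<integral>\<omega>\<in>?a. indicator b (Y \<omega>) \<partial>M) = (\<integral>\<omega>\<in>?a. real_cond_exp M ?A (\<lambda>\<omega>'. indicator b (Y \<omega>')) \<omega> \<partial>M)"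
      by (rule sub.real_cond_exp_intA[OF int_b a'])
    also have "\<dots> = (\<integral>\<omega>\<in>?a. measure (K (G \<omega>)) b \<partial>M)"
    proof (rule set_lebesgue_integral_cong_AE)
      show "AE \<omega> in M. \<omega> \<in> ?a \<longrightarrow> real_cond_exp M ?A (\<lambda>\<omega>'. indicator b (Y \<omega>')) \<omega> = measure (K (G \<omega>)) b"
        using law[OF b] by eventually_elim simp
      show "?a \<in> sets M"
        by (rule measurable_sets[OF G a])
    qed (rule borel_measurable_cond_exp2 mK)+
    finally have eq: "(\<integral>\<omega>\<in>?a. indicator b (Y \<omega>) \<partial>M) = (\<integral>\<omega>\<in>?a. measure (K (G \<omega>)) b \<partial>M)" .
    have "emeasure P X = emeasure M {\<omega>\<in>space M. G \<omega> \<in> a \<and> Y \<omega> \<in> b}"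
      unfolding P_def X by (subst emeasure_distr) (auto intro!: arg_cong[of _ _ "emeasure M"])
    also have "\<dots> = ennreal (\<integral>\<omega>. indicator {\<omega>\<in>space M. G \<omega> \<in> a \<and> Y \<omega> \<in> b} \<omega> \<partial>M)"
      unfolding emeasure_eq_measure by (subst Bochner_Integration.integral_indicator) (auto intro!: arg_cong[of _ _ "\<lambda>S. ennreal (measure M S)"])
    also have "(\<integral>\<omega>. indicator {\<omega>\<in>space M. G \<omega> \<in> a \<and> Y \<omega> \<in> b} \<omega> \<partial>M) = (\<integral>\<omega>\<in>?a. indicator b (Y \<omega>) \<partial>M)"
      unfolding set_lebesgue_integral_def by (intro Bochner_Integration.integral_cong) (auto simp: indicator_def)
    also have "ennreal \<dots> = (\<integral>\<^sup>+\<omega>. ennreal (indicator ?a \<omega> * measure (K (G \<omega>)) b) \<partial>M)"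
      unfolding eq unfolding set_lebesgue_integral_def real_scaleR_def
      by (rule nn_integral_eq_integral[symmetric, OF int_K]) simp
    also have "\<dots> = (\<integral>\<^sup>+\<omega>. emeasure (distr (K (G \<omega>)) (R \<Otimes>\<^sub>M L) (\<lambda>y. (G \<omega>, y))) X \<partial>M)"
    proof (rule nn_integral_cong)
      fix \<omega> assume \<omega>: "\<omega> \<in> space M"
      note [measurable_cong] = sets_K[OF \<omega>]
      have G\<omega>: "G \<omega> \<in> space R"
        using measurable_space[OF G \<omega>] .
      have "emeasure (distr (K (G \<omega>)) (R \<Otimes>\<^sub>M L) (\<lambda>y. (G \<omega>, y))) X =
          emeasure (K (G \<omega>)) ((\<lambda>y. (G \<omega>, y)) -` X \<inter> space (K (G \<omega>)))"
        unfolding X using G\<omega> by (intro emeasure_distr) measurable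
      also have "(\<lambda>y. (G \<omega>, y)) -` X \<inter> space (K (G \<omega>)) = (if G \<omega> \<in> a then b else {})"
        using sets.sets_into_space[OF b] sets_eq_imp_space_eq[OF sets_K[OF \<omega>]] by (auto simp: X)
      finally show "ennreal (indicator ?a \<omega> * measure (K (G \<omega>)) b) =
          emeasure (distr (K (G \<omega>)) (R \<Otimes>\<^sub>M L) (\<lambda>y. (G \<omega>, y))) X"
        using \<omega> finite_measure.emeasure_eq_measure[of "K (G \<omega>)" b] prob_K[OF \<omega>]
        by (simp add: indicator_def prob_space_def)
    qed
    also have "\<dots> = emeasure Q X"
      unfolding Q_def by (rule emeasure_bind[OF not_empty K'_sub, symmetric]) (auto simp: X)
    finally show "emeasure P X = emeasure Q X" .
  qed
  have "(\<integral>\<^sup>+\<omega>. F (G \<omega>, Y \<omega>) \<partial>M) = (\<integral>\<^sup>+z. F z \<partial>P)"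
    unfolding P_def by (subst nn_integral_distr) auto
  also have "\<dots> = (\<integral>\<^sup>+\<omega>. \<integral>\<^sup>+z. F z \<partial>distr (K (G \<omega>)) (R \<Otimes>\<^sub>M L) (\<lambda>y. (G \<omega>, y)) \<partial>M)"
    unfolding \<open>P = Q\<close> Q_def by (rule nn_integral_bind[OF F K'_sub])
  also have "\<dots> = (\<integral>\<^sup>+\<omega>. \<integral>\<^sup>+y. F (G \<omega>, y) \<partial>K (G \<omega>) \<partial>M)"
  proof (rule nn_integral_cong)
    fix \<omega> assume \<omega>: "\<omega> \<in> space M"
    note [measurable_cong] = sets_K[OF \<omega>]
    have "G \<omega> \<in> space R"
      using measurable_space[OF G \<omega>] .
    then show "(\<integral>\<^sup>+z. F z \<partial>distr (K (G \<omega>)) (R \<Otimes>\<^sub>M L) (\<lambda>y. (G \<omega>, y))) = (\<integral>\<^sup>+y. F (G \<omega>, y) \<partial>K (G \<omega>))"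
      by (intro nn_integral_distr) measurable
  qed
  finally show ?thesis .
qed

subsection \<open>The design matrix\<close>

lemma design_matrix_Suc:
  assumes "1 \<le> t"
  shows "design_matrix lam X (Suc t) = design_matrix lam X t + outer (X t) (X t)"
proof -
  have "{1..<Suc t} = insert t {1..<t}"
    using assms by auto
  then show ?thesis
    by (simp add: design_matrix_def outer_def add_ac)
qed

lemma design_matrix_cong:
  "(\<And>s. s \<in> {1..<t} \<Longrightarrow> X s = X' s) \<Longrightarrow> design_matrix lam X t = design_matrix lam X' t"
  unfolding design_matrix_def by (intro arg_cong2[of _ _ _ _ "(+)"] refl sum.cong) simp_all

lemma mat_vector_mult: "mat c *v (v :: real ^ 'n) = c *\<^sub>R v"
  by (simp add: matrix_vector_mult_def mat_def vec_eq_iff if_distrib[of "\<lambda>a. a * _"] cong: if_cong)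

lemma posdef_mat: "0 < c \<Longrightarrow> posdef (mat c)"
  unfolding posdef_def by (simp add: mat_vector_mult transpose_mat)

lemma posdef_design_matrix:
  assumes "0 < lam"
  shows "posdef (design_matrix lam X t)"
proof (induction t)
  case (Suc t)
  show ?case
  proof (cases "t = 0")
    case True
    then show ?thesis
      using posdef_mat[OF assms] by (simp add: design_matrix_def)
  next
    case False
    then show ?thesis
      using posdef_rank_one_update[OF Suc] by (simp add: design_matrix_Suc)
  qed
qed (use posdef_mat[OF assms] in \<open>simp add: design_matrix_def\<close>)

lemma design_matrix_mult:
  "design_matrix lam X t *v u = lam *\<^sub>R u + (\<Sum>s\<in>{1..<t}. (X s \<bullet> u) *\<^sub>R X s)"
proof -
  have "(\<Sum>s\<in>S. outer (X s) (X s)) *v u = (\<Sum>s\<in>S. (X s \<bullet> u) *\<^sub>R X s)" if "finite S" for S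
    using that
  proof induction
    case (insert s S)
    then show ?case
      by (simp add: matrix_vector_mult_add_rdistrib outer_vector_mult)
  qed simp
  then show ?thesis
    by (simp add: design_matrix_def matrix_vector_mult_add_rdistrib mat_vector_mult outer_def)
qed

lemma design_matrix_inverse_quadratic_form_le:
  assumes "0 < lam"
  shows "v \<bullet> (matrix_inv (design_matrix lam X t) *v v) \<le> (norm v)\<^sup>2 / lam"
proof -
  let ?A = "design_matrix lam X t"
  define w where "w = matrix_inv ?A *v v"
  have v: "v = ?A *v w"
    unfolding w_def by (simp add: posdef_inverse[OF posdef_design_matrix[OF assms]])
  have "lam * (w \<bullet> w) \<le> w \<bullet> v"
    unfolding v design_matrix_mult
    by (simp add: inner_add_right inner_sum_right sum_nonneg inner_commute)
  also have "w \<bullet> v \<le> norm w * norm v"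
    by (rule norm_cauchy_schwarz)
  finally have *: "norm w * (lam * norm w) \<le> norm w * norm v"
    by (simp add: power2_norm_eq_inner[symmetric] power2_eq_square mult_ac)
  have "lam * norm w \<le> norm v"
  proof (cases "w = 0")
    case False
    then show ?thesis
      using * by simp
  qed simp
  then have "norm w \<le> norm v / lam"
    using assms by (simp add: field_simps)
  then have "norm v * norm w \<le> norm v * (norm v / lam)"
    by (intro mult_left_mono) auto
  moreover have "v \<bullet> w \<le> norm v * norm w"
    by (rule norm_cauchy_schwarz)
  ultimately show ?thesis
    unfolding w_def by (simp add: power2_eq_square)
qed

lemma ln_det_design_matrix_le:
  fixes X :: "nat \<Rightarrow> real ^ 'n"
  assumes lam: "0 < lam" and t: "1 \<le> t" and X: "\<And>s. s \<in> {1..<t} \<Longrightarrow> norm (X s) \<le> 1"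
  shows "ln (det (design_matrix lam X t) / lam ^ CARD('n)) \<le>
    real CARD('n) * ln (1 + (real t - 1) / (real CARD('n) * lam))"
proof -
  let ?A = "design_matrix lam X t" and ?n = "real CARD('n)"
  define c where "c = lam + (real t - 1) / ?n"
  have c: "0 < c"
    unfolding c_def using lam t by (intro add_pos_nonneg) auto
  have tr_outer: "trace (outer v v) = (norm v)\<^sup>2" for v :: "real ^ 'n"
    by (simp add: trace_def outer_def power2_norm_eq_inner inner_vec_def)
  have tr_sum: "trace (\<Sum>s\<in>S. outer (X s) (X s)) = (\<Sum>s\<in>S. (norm (X s))\<^sup>2)" if "finite S" for S
    using that
  proof induction
    case empty
    show ?case by (simp add: trace_def)
  next
    case (insert s S)
    then show ?case by (simp add: trace_add tr_outer)
  qed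
  have "trace ?A = ?n * lam + (\<Sum>s\<in>{1..<t}. (norm (X s))\<^sup>2)"
    using tr_sum[of "{1..<t}"]
    by (simp add: design_matrix_def trace_add outer_def) (simp add: trace_def mat_def)
  also have "(\<Sum>s\<in>{1..<t}. (norm (X s))\<^sup>2) \<le> (\<Sum>s\<in>{1..<t}. 1)"
    using X by (intro sum_mono) (simp add: power_le_one)
  also have "?n * lam + (\<Sum>s\<in>{1..<t}. 1) = ?n * c"
    using t by (simp add: c_def distrib_left of_nat_diff)
  finally have "ln (det ?A) \<le> ?n * ln c"
    by (intro posdef_ln_det_le posdef_design_matrix lam c) simp
  moreover have "ln (det ?A / lam ^ CARD('n)) = ln (det ?A) - ?n * ln lam"
  proof -
    have "0 < det ?A"
      by (intro Hadamard_inequality(1) posdef_design_matrix lam)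
    then show ?thesis
      using lam by (simp add: ln_div ln_realpow)
  qed
  moreover have "ln (1 + (real t - 1) / (?n * lam)) = ln c - ln lam"
  proof -
    have "1 + (real t - 1) / (?n * lam) = c / lam"
      using lam by (simp add: c_def add_divide_distrib)
    then show ?thesis
      using lam c by (simp add: ln_div)
  qed
  ultimately show ?thesis
    by (simp add: right_diff_distrib)
qed

lemma min_one_le_ln: "0 \<le> q \<Longrightarrow> min 1 q \<le> 2 * ln (1 + q)" for q :: real
proof -
  assume q: "0 \<le> q"
  have "ln (1 / (1 + q)) \<le> 1 / (1 + q) - 1"
    using q by (intro ln_le_minus_one) simp
  then have "1 - 1 / (1 + q) \<le> ln (1 + q)"
    using q by (simp add: ln_div)
  moreover have "1 - 1 / (1 + q) = q / (1 + q)"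
    using q by (simp add: field_simps)
  moreover have "min 1 q \<le> 2 * (q / (1 + q))"
  proof (cases "q \<le> 1")
    case True
    then have "q * (1 + q) \<le> q * 2"
      using q by (intro mult_left_mono) auto
    then show ?thesis
      using q True by (simp add: pos_le_divide_eq min_def)
  next
    case False
    then show ?thesis
      by (simp add: pos_le_divide_eq min_def)
  qed
  ultimately show ?thesis by linarith
qed

lemma sum_min_one_le_ln_det:
  fixes X :: "nat \<Rightarrow> real ^ 'n"
  assumes lam: "0 < lam"
  shows "(\<Sum>s=1..t. min 1 (X s \<bullet> (matrix_inv (design_matrix lam X s) *v X s))) \<le>
    2 * ln (det (design_matrix lam X (Suc t)) / lam ^ CARD('n))"
proof (induction t)
  case 0
  have "det (design_matrix lam X (Suc 0)) = lam ^ CARD('n)"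
    by (simp add: design_matrix_def det_diagonal mat_def)
  then show ?case using lam by simp
next
  case (Suc t)
  let ?A = "design_matrix lam X (Suc t)" and ?v = "X (Suc t)"
  let ?q = "?v \<bullet> (matrix_inv ?A *v ?v)"
  note A = posdef_design_matrix[OF lam, of X "Suc t"]
  have q: "0 \<le> ?q"
    by (rule posdef_nonneg[OF posdef_matrix_inv[OF A]])
  have "det (design_matrix lam X (Suc (Suc t))) = det ?A * (1 + ?q)"
    by (simp add: design_matrix_Suc[of "Suc t"] det_rank_one_update[OF A])
  then have "ln (det (design_matrix lam X (Suc (Suc t))) / lam ^ CARD('n)) =
      ln (det ?A / lam ^ CARD('n)) + ln (1 + ?q)"
    using Hadamard_inequality(1)[OF A] lam q by (simp add: ln_mult ln_div)
  then show ?case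
    using Suc min_one_le_ln[OF q] by simp
qed

lemma borel_measurable_det:
  fixes A :: "'b \<Rightarrow> real ^ 'n ^ 'n"
  assumes "\<And>i j. (\<lambda>\<omega>. A \<omega> $ i $ j) \<in> borel_measurable R"
  shows "(\<lambda>\<omega>. det (A \<omega>)) \<in> borel_measurable R"
  unfolding det_def by (intro borel_measurable_sum borel_measurable_times borel_measurable_prod
      borel_measurable_const assms)

lemma borel_measurable_matrix_inv_form:
  fixes A :: "'b \<Rightarrow> real ^ 'n ^ 'n"
  assumes A: "\<And>i j. (\<lambda>\<omega>. A \<omega> $ i $ j) \<in> borel_measurable R" and pos: "\<And>\<omega>. \<omega> \<in> space R \<Longrightarrow> posdef (A \<omega>)"
    and u[measurable]: "u \<in> borel_measurable R" and v[measurable]: "v \<in> borel_measurable R"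
  shows "(\<lambda>\<omega>. u \<omega> \<bullet> (matrix_inv (A \<omega>) *v v \<omega>)) \<in> borel_measurable R"
proof -
  have comp: "(\<lambda>\<omega>. w \<omega> $ i) \<in> borel_measurable R" if [measurable]: "w \<in> borel_measurable R"
    for w :: "'b \<Rightarrow> real ^ 'n" and i
  proof -
    have "(\<lambda>\<omega>. w \<omega> \<bullet> axis i 1) \<in> borel_measurable R" by measurable
    then show ?thesis by (simp add: inner_axis)
  qed
  have "(\<lambda>\<omega>. \<Sum>k\<in>UNIV. u \<omega> $ k * (det (\<chi> i j. if j = k then v \<omega> $ i else A \<omega> $ i $ j) / det (A \<omega>)))
      \<in> borel_measurable R"
  proof (rule borel_measurable_sum)
    fix k
    have "(\<lambda>\<omega>. (\<chi> i j. if j = k then v \<omega> $ i else A \<omega> $ i $ j) $ i $ j) \<in> borel_measurable R" for i j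
      using A comp[OF v] by (cases "j = k") simp_all
    note [measurable] = borel_measurable_det[OF this] borel_measurable_det[OF A] comp[OF u]
    show "(\<lambda>\<omega>. u \<omega> $ k * (det (\<chi> i j. if j = k then v \<omega> $ i else A \<omega> $ i $ j) / det (A \<omega>)))
        \<in> borel_measurable R"
      by measurable
  qed
  also have "?this \<longleftrightarrow> ?thesis"
  proof (rule measurable_cong)
    fix \<omega> assume \<omega>: "\<omega> \<in> space R"
    have "matrix_inv (A \<omega>) *v v \<omega> = (\<chi> k. det (\<chi> i j. if j = k then v \<omega> $ i else A \<omega> $ i $ j) / det (A \<omega>))"
      using cramer[OF posdef_det_nonzero[OF pos[OF \<omega>]]] posdef_inverse(1)[OF pos[OF \<omega>]] by blast
    then show "(\<Sum>k\<in>UNIV. u \<omega> $ k * (det (\<chi> i j. if j = k then v \<omega> $ i else A \<omega> $ i $ j) / det (A \<omega>))) =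
        u \<omega> \<bullet> (matrix_inv (A \<omega>) *v v \<omega>)"
      by (simp add: inner_vec_def)
  qed
  finally show ?thesis .
qed

lemma borel_measurable_design_matrix:
  fixes X :: "nat \<Rightarrow> 'b \<Rightarrow> real ^ 'n"
  assumes X: "\<And>s. s \<in> {1..<t} \<Longrightarrow> X s \<in> borel_measurable R"
  shows "(\<lambda>\<omega>. design_matrix lam (\<lambda>s. X s \<omega>) t $ i $ j) \<in> borel_measurable R"
proof -
  have comp: "(\<lambda>\<omega>. X s \<omega> $ k) \<in> borel_measurable R" if "s \<in> {1..<t}" for s k
  proof -
    note [measurable] = X[OF that]
    have "(\<lambda>\<omega>. X s \<omega> \<bullet> axis k 1) \<in> borel_measurable R" by measurable
    then show ?thesis by (simp add: inner_axis)
  qed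
  have "(\<lambda>\<omega>. mat lam $ i $ j + (\<Sum>s\<in>{1..<t}. X s \<omega> $ i * X s \<omega> $ j)) \<in> borel_measurable R"
    by (intro borel_measurable_add borel_measurable_const borel_measurable_sum borel_measurable_times comp)
  then show ?thesis
    by (simp add: design_matrix_def)
qed

subsection \<open>Confidence of the ridge estimate\<close>

definition noise_sum :: "real ^ 'n \<Rightarrow> (nat \<Rightarrow> real ^ 'n) \<Rightarrow> (nat \<Rightarrow> real) \<Rightarrow> nat \<Rightarrow> real ^ 'n" where
  "noise_sum \<theta> X Y t = (\<Sum>s\<in>{1..<t}. (Y s - X s \<bullet> \<theta>) *\<^sub>R X s)"

definition potential :: "real \<Rightarrow> real ^ 'n \<Rightarrow> (nat \<Rightarrow> real ^ 'n) \<Rightarrow> (nat \<Rightarrow> real) \<Rightarrow> nat \<Rightarrow> real" where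
  "potential lam \<theta> X Y t =
    exp (2 * (noise_sum \<theta> X Y t \<bullet> (matrix_inv (design_matrix lam X t) *v noise_sum \<theta> X Y t)))
      / sqrt (det (design_matrix lam X t) / lam ^ CARD('n))"

lemma noise_sum_Suc:
  assumes "1 \<le> t"
  shows "noise_sum \<theta> X Y (Suc t) = noise_sum \<theta> X Y t + (Y t - X t \<bullet> \<theta>) *\<^sub>R X t"
proof -
  have "{1..<Suc t} = insert t {1..<t}"
    using assms by auto
  then show ?thesis
    by (simp add: noise_sum_def add_ac)
qed

lemma potential_nonneg:
  assumes "0 < lam"
  shows "0 \<le> potential lam \<theta> X Y t"
  using Hadamard_inequality(1)[OF posdef_design_matrix[OF assms, of X t]] assms
  by (simp add: potential_def)

lemma potential_1:
  fixes \<theta> :: "real ^ 'n"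
  assumes "0 < lam"
  shows "potential lam \<theta> X Y 1 = 1"
proof -
  have "det (design_matrix lam X 1) = lam ^ CARD('n)"
    by (simp add: design_matrix_def det_diagonal mat_def)
  then show ?thesis
    using assms by (simp add: potential_def noise_sum_def)
qed

lemma potential_Suc:
  fixes X :: "nat \<Rightarrow> real ^ 'n" and Y :: "nat \<Rightarrow> real" and \<theta> :: "real ^ 'n"
  assumes lam: "0 < lam" and t: "1 \<le> t"
  defines "A \<equiv> matrix_inv (design_matrix lam X t)"
  defines "q \<equiv> X t \<bullet> (A *v X t)" and "b \<equiv> X t \<bullet> (A *v noise_sum \<theta> X Y t)"
    and "c \<equiv> Y t - X t \<bullet> \<theta>"
  shows "potential lam \<theta> X Y (Suc t) =
    potential lam \<theta> X Y t * (exp (2 * (2 * c * b + c\<^sup>2 * q - b\<^sup>2) / (1 + q)) / sqrt (1 + q))"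
proof -
  let ?V = "design_matrix lam X t" and ?S = "noise_sum \<theta> X Y t"
  note V = posdef_design_matrix[OF lam, of X t]
  have form: "(?S + c *\<^sub>R X t) \<bullet> (matrix_inv (?V + outer (X t) (X t)) *v (?S + c *\<^sub>R X t)) =
      ?S \<bullet> (A *v ?S) + (2 * c * b + c\<^sup>2 * q - b\<^sup>2) / (1 + q)"
    unfolding A_def q_def b_def by (rule rank_one_update_quadratic_form[OF V])
  have det: "det (?V + outer (X t) (X t)) / lam ^ CARD('n) = det ?V / lam ^ CARD('n) * (1 + q)"
    unfolding A_def q_def by (simp add: det_rank_one_update[OF V])
  have "exp (2 * (a + e / r)) / sqrt (D * r) = exp (2 * a) / sqrt D * (exp (2 * e / r) / sqrt r)"
    for a e r D :: real
    by (simp add: distrib_left exp_add real_sqrt_mult)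
  then show ?thesis
    unfolding potential_def noise_sum_Suc[OF t] design_matrix_Suc[OF t] c_def[symmetric] form det
    unfolding A_def by this
qed

lemma ridge_estimate_error:
  assumes "0 < lam"
  shows "(ridge_estimate lam X Y t - \<theta>) \<bullet> v =
    (noise_sum \<theta> X Y t - lam *\<^sub>R \<theta>) \<bullet> (matrix_inv (design_matrix lam X t) *v v)"
proof -
  let ?V = "design_matrix lam X t"
  note V = posdef_design_matrix[OF assms, of X t]
  have "(\<Sum>s\<in>{1..<t}. Y s *\<^sub>R X s) = noise_sum \<theta> X Y t + (\<Sum>s\<in>{1..<t}. (X s \<bullet> \<theta>) *\<^sub>R X s)"
    unfolding noise_sum_def sum.distrib[symmetric] by (simp add: scaleR_left_diff_distrib)
  then have "(\<Sum>s\<in>{1..<t}. Y s *\<^sub>R X s) = (noise_sum \<theta> X Y t - lam *\<^sub>R \<theta>) + ?V *v \<theta>"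
    by (simp add: design_matrix_mult)
  then have "ridge_estimate lam X Y t - \<theta> = matrix_inv ?V *v (noise_sum \<theta> X Y t - lam *\<^sub>R \<theta>)"
    unfolding ridge_estimate_def by (simp only: matrix_vector_right_distrib posdef_inverse[OF V] add_diff_cancel_right')
  then show ?thesis
    using posdef_symD[OF posdef_matrix_inv[OF V], of "noise_sum \<theta> X Y t - lam *\<^sub>R \<theta>" v] by (simp only:)
qed

lemma abs_bilinear_le_matrix_norm:
  assumes "posdef A"
  shows "\<bar>u \<bullet> (A *v v)\<bar> \<le> matrix_norm A u * matrix_norm A v"
  using real_sqrt_le_mono[OF posdef_Cauchy_Schwarz[OF assms, of u v]]
  by (simp add: matrix_norm_def real_sqrt_mult)

lemma ridge_estimate_confidence:
  fixes X :: "nat \<Rightarrow> real ^ 'n"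
  assumes n: "1 < CARD('n)" and lam: "0 < lam" and t: "t \<in> {1..T}"
    and X: "\<And>s. s \<in> {1..<t} \<Longrightarrow> norm (X s) \<le> 1" and \<theta>: "norm \<theta> \<le> 1"
    and pot: "potential lam \<theta> X Y t \<le> real T"
  defines "d \<equiv> real CARD('n)"
  shows "\<bar>(ridge_estimate lam X Y t - \<theta>) \<bullet> v\<bar> \<le>
    (sqrt lam + 1 / 2 * sqrt (d * ln (real T + (real T)\<^sup>2 / (d * lam)))) *
      matrix_norm (matrix_inv (design_matrix lam X t)) v"
proof -
  let ?V = "design_matrix lam X t" and ?S = "noise_sum \<theta> X Y t"
  let ?N = "matrix_norm (matrix_inv ?V)"
  define D where "D = det ?V / lam ^ CARD('n)"
  define g where "g = ?S \<bullet> (matrix_inv ?V *v ?S)"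
  define L where "L = d * ln (real T + (real T)\<^sup>2 / (d * lam))"
  note V = posdef_design_matrix[OF lam, of X t]
  note W = posdef_matrix_inv[OF V]
  have T: "1 \<le> real T"
    using t by simp
  have d: "2 \<le> d"
    using n by (simp add: d_def)
  have D: "0 < D"
    unfolding D_def using Hadamard_inequality(1)[OF V] lam by simp
  have "exp (2 * g) \<le> real T * sqrt D"
    using pot D unfolding potential_def D_def[symmetric] g_def[symmetric] by (simp add: pos_divide_le_eq)
  then have "2 * g \<le> ln (real T * sqrt D)"
    using D T by (subst ln_ge_iff) auto
  then have "2 * g \<le> ln (real T) + ln D / 2"
    using D T by (simp add: ln_mult ln_sqrt)
  moreover have "ln D \<le> d * ln (1 + real T / (d * lam))"
  proof -
    have "ln D \<le> d * ln (1 + (real t - 1) / (d * lam))"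
      unfolding D_def d_def using t by (intro ln_det_design_matrix_le lam X) auto
    also have "\<dots> \<le> d * ln (1 + real T / (d * lam))"
    proof -
      have "1 + (real t - 1) / (d * lam) \<le> 1 + real T / (d * lam)"
        using t d lam by (intro add_left_mono divide_right_mono) auto
      moreover have "0 < 1 + (real t - 1) / (d * lam)"
        using t d lam by (intro add_pos_nonneg) auto
      ultimately show ?thesis
        using d by (intro mult_left_mono) auto
    qed
    finally show ?thesis .
  qed
  moreover have "2 * ln (real T) \<le> d * ln (real T)"
    using T d by (intro mult_right_mono) auto
  moreover have "L = d * ln (real T) + d * ln (1 + real T / (d * lam))"
  proof -
    have eq: "real T + (real T)\<^sup>2 / (d * lam) = real T * (1 + real T / (d * lam))"
      by (simp add: distrib_left power2_eq_square)
    have "0 < 1 + real T / (d * lam)"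
      using T d lam by (intro add_pos_nonneg) auto
    then show ?thesis
      unfolding L_def eq using T by (subst ln_mult) (auto simp: distrib_left)
  qed
  ultimately have "g \<le> L / 4" by linarith
  then have "sqrt g \<le> sqrt (L / 4)" by simp
  then have S: "?N ?S \<le> 1 / 2 * sqrt L"
    by (simp add: matrix_norm_def g_def real_sqrt_divide)
  have "\<theta> \<bullet> (matrix_inv ?V *v \<theta>) \<le> 1 / lam"
  proof -
    have "\<theta> \<bullet> (matrix_inv ?V *v \<theta>) \<le> (norm \<theta>)\<^sup>2 / lam"
      by (rule design_matrix_inverse_quadratic_form_le[OF lam])
    also have "\<dots> \<le> 1 / lam"
      using \<theta> lam by (intro divide_right_mono) (auto simp: power_le_one)
    finally show ?thesis .
  qed
  then have "?N \<theta> \<le> 1 / sqrt lam"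
    unfolding matrix_norm_def by (metis real_sqrt_divide real_sqrt_le_mono real_sqrt_one)
  then have "lam * ?N \<theta> \<le> lam * (1 / sqrt lam)"
    using lam by (intro mult_left_mono) auto
  also have "\<dots> = sqrt lam"
    using lam by (simp add: real_div_sqrt)
  finally have th: "lam * ?N \<theta> \<le> sqrt lam" .
  have Nv: "0 \<le> ?N v"
    unfolding matrix_norm_def using posdef_nonneg[OF W] by simp
  have "\<bar>(ridge_estimate lam X Y t - \<theta>) \<bullet> v\<bar> \<le>
      \<bar>?S \<bullet> (matrix_inv ?V *v v)\<bar> + lam * \<bar>\<theta> \<bullet> (matrix_inv ?V *v v)\<bar>"
  proof -
    have "\<bar>lam * (\<theta> \<bullet> (matrix_inv ?V *v v))\<bar> = lam * \<bar>\<theta> \<bullet> (matrix_inv ?V *v v)\<bar>"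
      using lam by (simp add: abs_mult)
    then show ?thesis
      unfolding ridge_estimate_error[OF lam] unfolding inner_diff_left inner_scaleR_left
      using abs_triangle_ineq4[of "?S \<bullet> (matrix_inv ?V *v v)" "lam * (\<theta> \<bullet> (matrix_inv ?V *v v))"] by linarith
  qed
  also have "\<dots> \<le> ?N ?S * ?N v + lam * (?N \<theta> * ?N v)"
    using lam by (intro add_mono mult_left_mono abs_bilinear_le_matrix_norm[OF W]) auto
  also have "\<dots> = (?N ?S + lam * ?N \<theta>) * ?N v"
    by (simp add: distrib_right)
  also have "\<dots> \<le> (1 / 2 * sqrt L + sqrt lam) * ?N v"
    using S th Nv by (intro mult_right_mono add_mono) auto
  finally show ?thesis
    unfolding L_def by (simp only: add.commute)
qed

lemma noise_sum_cong:
  "(\<And>s. s \<in> {1..<t} \<Longrightarrow> X s = X' s \<and> Y s = Y' s) \<Longrightarrow> noise_sum \<theta> X Y t = noise_sum \<theta> X' Y' t"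
  unfolding noise_sum_def by (intro sum.cong) simp_all

lemma potential_cong:
  assumes "\<And>s. s \<in> {1..<t} \<Longrightarrow> X s = X' s \<and> Y s = Y' s"
  shows "potential lam \<theta> X Y t = potential lam \<theta> X' Y' t"
proof -
  have "noise_sum \<theta> X Y t = noise_sum \<theta> X' Y' t" "design_matrix lam X t = design_matrix lam X' t"
    using assms by (auto intro: noise_sum_cong design_matrix_cong)
  then show ?thesis
    by (simp only: potential_def)
qed

lemma borel_measurable_noise_sum:
  fixes X :: "nat \<Rightarrow> 'b \<Rightarrow> real ^ 'n"
  assumes X: "\<And>s. s \<in> {1..<t} \<Longrightarrow> X s \<in> borel_measurable R"
    and Y: "\<And>s. s \<in> {1..<t} \<Longrightarrow> Y s \<in> borel_measurable R"
  shows "(\<lambda>\<omega>. noise_sum \<theta> (\<lambda>s. X s \<omega>) (\<lambda>s. Y s \<omega>) t) \<in> borel_measurable R"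
  unfolding noise_sum_def
  by (intro borel_measurable_sum borel_measurable_scaleR borel_measurable_diff borel_measurable_inner
      borel_measurable_const X Y)

lemma borel_measurable_potential:
  fixes X :: "nat \<Rightarrow> 'b \<Rightarrow> real ^ 'n"
  assumes lam: "0 < lam" and X: "\<And>s. s \<in> {1..<t} \<Longrightarrow> X s \<in> borel_measurable R"
    and Y: "\<And>s. s \<in> {1..<t} \<Longrightarrow> Y s \<in> borel_measurable R"
  shows "(\<lambda>\<omega>. potential lam \<theta> (\<lambda>s. X s \<omega>) (\<lambda>s. Y s \<omega>) t) \<in> borel_measurable R"
proof -
  note V = borel_measurable_design_matrix[OF X]
  note [measurable] = borel_measurable_det[OF V]
    borel_measurable_matrix_inv_form[OF V posdef_design_matrix[OF lam]
      borel_measurable_noise_sum[OF X Y] borel_measurable_noise_sum[OF X Y]]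
  show ?thesis
    unfolding potential_def by measurable
qed

lemma measurable_history_component:
  "s \<in> {1..<t} \<Longrightarrow> (\<lambda>h. h s) \<in> history_space \<A> t \<rightarrow>\<^sub>M \<A> \<Otimes>\<^sub>M borel"
  unfolding history_space_def by (rule measurable_component_singleton)

context linear_bandit
begin

lemma reward_kernelD:
  assumes "a \<in> space \<A>"
  shows "prob_space (\<nu> a)" "sets (\<nu> a) = sets borel"
  using measurable_space[OF reward_kernel assms] by (auto simp: space_prob_algebra)

lemma mean_bounds:
  assumes "a \<in> space \<A>"
  shows "0 \<le> x a \<bullet> \<theta>" "x a \<bullet> \<theta> \<le> 1"
proof -
  interpret prob_space "\<nu> a"
    by (rule reward_kernelD[OF assms])
  have AE: "AE y in \<nu> a. 0 \<le> y" "AE y in \<nu> a. y \<le> 1"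
    by (rule eventually_mono[OF reward_range[OF assms]]; simp)+
  have "(\<lambda>y. y) \<in> borel_measurable (\<nu> a)"
    unfolding measurable_cong_sets[OF reward_kernelD(2)[OF assms] refl] by simp
  then have "integrable (\<nu> a) (\<lambda>y. y)"
    by (rule integrable_const_bound[where B = 1, rotated]) (rule eventually_mono[OF reward_range[OF assms]], simp)
  then show "0 \<le> x a \<bullet> \<theta>" "x a \<bullet> \<theta> \<le> 1"
    unfolding reward_mean[OF assms, symmetric]
    using integral_nonneg_AE[OF AE(1)] integral_le_const[OF _ AE(2)] by blast+
qed

lemma borel_measurable_history_feature:
  assumes "s \<in> {1..<t}"
  shows "(\<lambda>h. x (fst (h s))) \<in> borel_measurable (history_space \<A> t)"
    "(\<lambda>h. snd (h s)) \<in> borel_measurable (history_space \<A> t)"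
proof -
  note [measurable] = measurable_history_component[OF assms, of \<A>] features_measurable
  show "(\<lambda>h. x (fst (h s))) \<in> borel_measurable (history_space \<A> t)"
    "(\<lambda>h. snd (h s)) \<in> borel_measurable (history_space \<A> t)"
    by measurable
qed

end

context bandit_run
begin

lemma measurable_history:
  assumes "t \<in> {1..T}"
  shows "history I Y t \<in> M \<rightarrow>\<^sub>M history_space \<A> t"
proof -
  have "(\<lambda>\<omega>. \<lambda>s\<in>{1..<t}. (I s \<omega>, Y s \<omega>)) \<in> M \<rightarrow>\<^sub>M history_space \<A> t"
    unfolding history_space_def
    by (intro measurable_restrict measurable_Pair pull_measurable reward_measurable) (use assms in auto)
  then show ?thesis
    by (simp add: history_def[abs_def])
qed

lemma borel_measurable_feature:
  "t \<in> {1..T} \<Longrightarrow> (\<lambda>\<omega>. x (I t \<omega>)) \<in> borel_measurable M"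
  by (rule measurable_compose[OF pull_measurable features_measurable])

lemma history_apply: "s \<in> {1..<t} \<Longrightarrow> history I Y t \<omega> s = (I s \<omega>, Y s \<omega>)"
  by (simp add: history_def)

lemma nn_integral_reward_law:
  assumes t: "t \<in> {1..T}" and F: "F \<in> borel_measurable ((history_space \<A> t \<Otimes>\<^sub>M \<A>) \<Otimes>\<^sub>M borel)"
  shows "(\<integral>\<^sup>+\<omega>. F ((history I Y t \<omega>, I t \<omega>), Y t \<omega>) \<partial>M) =
    (\<integral>\<^sup>+\<omega>. \<integral>\<^sup>+y. F ((history I Y t \<omega>, I t \<omega>), y) \<partial>\<nu> (I t \<omega>) \<partial>M)"
proof -
  have "(\<lambda>g. \<nu> (snd g)) \<in> (history_space \<A> t \<Otimes>\<^sub>M \<A>) \<rightarrow>\<^sub>M prob_algebra borel"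
    by (rule measurable_compose[OF measurable_snd reward_kernel])
  then show ?thesis
    using nn_integral_conditional_kernel[OF measurable_Pair[OF measurable_history[OF t] pull_measurable[OF t]]
        reward_measurable[OF t], of "\<lambda>g. \<nu> (snd g)" F] F reward_law[OF t]
    by (simp add: pull_algebra_def)
qed

abbreviation run_potential :: "real \<Rightarrow> nat \<Rightarrow> 'w \<Rightarrow> real" where
  "run_potential lam t \<omega> \<equiv> potential lam \<theta> (\<lambda>s. x (I s \<omega>)) (\<lambda>s. Y s \<omega>) t"

lemma nn_integral_potential_Suc_le:
  assumes lam: "0 < lam" and t: "t \<in> {1..T}"
  shows "(\<integral>\<^sup>+\<omega>. run_potential lam (Suc t) \<omega> \<partial>M) \<le> (\<integral>\<^sup>+\<omega>. run_potential lam t \<omega> \<partial>M)"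
proof -
  define X' :: "(nat \<Rightarrow> 'a \<times> real) \<Rightarrow> nat \<Rightarrow> real ^ 'd" where "X' h s = x (fst (h s))" for h s
  define Y' :: "(nat \<Rightarrow> 'a \<times> real) \<Rightarrow> nat \<Rightarrow> real" where "Y' h s = snd (h s)" for h s
  define V where "V h = design_matrix lam (X' h) t" for h
  define q where "q h a = x a \<bullet> (matrix_inv (V h) *v x a)" for h a
  define b where "b h a = x a \<bullet> (matrix_inv (V h) *v noise_sum \<theta> (X' h) (Y' h) t)" for h a
  define f where "f h a y = exp (2 * (2 * (y - x a \<bullet> \<theta>) * b h a + (y - x a \<bullet> \<theta>)\<^sup>2 * q h a - (b h a)\<^sup>2) / (1 + q h a))
      / sqrt (1 + q h a)" for h a y
  define p where "p h = potential lam \<theta> (X' h) (Y' h) t" for h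
  let ?H = "history_space \<A> t"
  have X'[measurable]: "(\<lambda>h. X' h s) \<in> borel_measurable ?H" and Y'[measurable]: "(\<lambda>h. Y' h s) \<in> borel_measurable ?H"
    if "s \<in> {1..<t}" for s
    using borel_measurable_history_feature[OF that] by (simp_all add: X'_def Y'_def)
  have p[measurable]: "p \<in> borel_measurable ?H"
    unfolding p_def by (rule borel_measurable_potential[OF lam X' Y'])
  note [measurable] = features_measurable
  have x[measurable]: "(\<lambda>g. x (snd g)) \<in> borel_measurable (?H \<Otimes>\<^sub>M \<A>)"
    by measurable
  have V: "(\<lambda>g. V (fst g) $ i $ j) \<in> borel_measurable (?H \<Otimes>\<^sub>M \<A>)" for i j
    unfolding V_def by (rule measurable_compose[OF measurable_fst borel_measurable_design_matrix[OF X']])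
  have posV: "posdef (V h)" for h
    unfolding V_def by (rule posdef_design_matrix[OF lam])
  have S: "(\<lambda>g. noise_sum \<theta> (X' (fst g)) (Y' (fst g)) t) \<in> borel_measurable (?H \<Otimes>\<^sub>M \<A>)"
    by (rule measurable_compose[OF measurable_fst borel_measurable_noise_sum[OF X' Y']])
  have q[measurable]: "(\<lambda>g. q (fst g) (snd g)) \<in> borel_measurable (?H \<Otimes>\<^sub>M \<A>)"
    unfolding q_def by (rule borel_measurable_matrix_inv_form[OF V posV x x])
  have b[measurable]: "(\<lambda>g. b (fst g) (snd g)) \<in> borel_measurable (?H \<Otimes>\<^sub>M \<A>)"
    unfolding b_def by (rule borel_measurable_matrix_inv_form[OF V posV x S])
  define F where "F z = ennreal (p (fst (fst z)) * f (fst (fst z)) (snd (fst z)) (snd z))" for z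
  have F: "F \<in> borel_measurable ((?H \<Otimes>\<^sub>M \<A>) \<Otimes>\<^sub>M borel)"
  proof -
    note [measurable] = measurable_compose[OF measurable_fst q] measurable_compose[OF measurable_fst b]
      measurable_compose[OF measurable_fst x]
    show ?thesis
      unfolding F_def f_def by measurable
  qed
  have eqs: "X' (history I Y t \<omega>) s = x (I s \<omega>)" "Y' (history I Y t \<omega>) s = Y s \<omega>"
    if "s \<in> {1..<t}" for s \<omega>
    using history_apply[OF that] by (simp_all add: X'_def Y'_def)
  have p_eq: "p (history I Y t \<omega>) = run_potential lam t \<omega>" for \<omega>
    unfolding p_def by (rule potential_cong) (simp add: eqs)
  have V_eq: "V (history I Y t \<omega>) = design_matrix lam (\<lambda>s. x (I s \<omega>)) t" for \<omega>
    unfolding V_def by (rule design_matrix_cong) (simp add: eqs)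
  have S_eq: "noise_sum \<theta> (X' (history I Y t \<omega>)) (Y' (history I Y t \<omega>)) t =
      noise_sum \<theta> (\<lambda>s. x (I s \<omega>)) (\<lambda>s. Y s \<omega>) t" for \<omega>
    by (rule noise_sum_cong) (simp add: eqs)
  have "F ((history I Y t \<omega>, I t \<omega>), Y t \<omega>) = ennreal (run_potential lam (Suc t) \<omega>)" for \<omega>
    unfolding F_def fst_conv snd_conv p_eq f_def q_def b_def V_eq S_eq
    using t by (subst potential_Suc[OF lam]) simp_all
  then have "(\<integral>\<^sup>+\<omega>. run_potential lam (Suc t) \<omega> \<partial>M) = (\<integral>\<^sup>+\<omega>. F ((history I Y t \<omega>, I t \<omega>), Y t \<omega>) \<partial>M)"
    by simp
  also have "\<dots> = (\<integral>\<^sup>+\<omega>. \<integral>\<^sup>+y. F ((history I Y t \<omega>, I t \<omega>), y) \<partial>\<nu> (I t \<omega>) \<partial>M)"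
    by (rule nn_integral_reward_law[OF t F])
  also have "\<dots> \<le> (\<integral>\<^sup>+\<omega>. run_potential lam t \<omega> \<partial>M)"
  proof (rule nn_integral_mono)
    fix \<omega> assume \<omega>: "\<omega> \<in> space M"
    let ?h = "history I Y t \<omega>" and ?a = "I t \<omega>"
    have a: "?a \<in> space \<A>"
      by (rule measurable_space[OF pull_measurable[OF t] \<omega>])
    note \<nu> = reward_kernelD[OF a]
    have q0: "0 \<le> q ?h ?a"
      unfolding q_def by (rule posdef_nonneg[OF posdef_matrix_inv[OF posV]])
    have p0: "0 \<le> p ?h"
      unfolding p_def by (rule potential_nonneg[OF lam])
    have f: "f ?h ?a \<in> borel_measurable (\<nu> ?a)"
      unfolding f_def measurable_cong_sets[OF \<nu>(2) refl] by measurable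
    have "(\<integral>\<^sup>+y. F ((?h, ?a), y) \<partial>\<nu> ?a) = (\<integral>\<^sup>+y. ennreal (p ?h) * ennreal (f ?h ?a y) \<partial>\<nu> ?a)"
      unfolding F_def fst_conv snd_conv using p0 by (intro nn_integral_cong) (simp add: ennreal_mult')
    also have "\<dots> = ennreal (p ?h) * (\<integral>\<^sup>+y. ennreal (f ?h ?a y) \<partial>\<nu> ?a)"
      by (rule nn_integral_cmult) (use f in measurable)
    also have "(\<integral>\<^sup>+y. ennreal (f ?h ?a y) \<partial>\<nu> ?a) \<le> 1"
      unfolding f_def reward_mean[OF a, symmetric] by (rule nn_integral_exp_quadratic_le[OF \<nu> reward_range[OF a] q0])
    finally show "(\<integral>\<^sup>+y. F ((?h, ?a), y) \<partial>\<nu> ?a) \<le> ennreal (run_potential lam t \<omega>)"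
      by (simp add: p_eq mult_left_mono)
  qed
  finally show ?thesis .
qed

lemma nn_integral_potential_le_1:
  assumes lam: "0 < lam" and "t \<in> {1..T}"
  shows "(\<integral>\<^sup>+\<omega>. run_potential lam t \<omega> \<partial>M) \<le> 1"
proof -
  have "1 \<le> t" "t \<le> T"
    using assms by auto
  then show ?thesis
  proof (induction t rule: dec_induct)
    case base
    then show ?case
      unfolding potential_1[OF lam] by (simp add: emeasure_space_1)
  next
    case (step t)
    then show ?case
      using nn_integral_potential_Suc_le[OF lam, of t] by (auto intro: order_trans)
  qed
qed

lemma prob_potential_gt_le:
  assumes lam: "0 < lam" and t: "t \<in> {1..T}"
  shows "prob {\<omega>\<in>space M. real T < run_potential lam t \<omega>} \<le> 1 / real T"
proof -
  have [measurable]: "run_potential lam t \<in> borel_measurable M"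
    by (rule borel_measurable_potential[OF lam borel_measurable_feature reward_measurable]) (use t in auto)
  have T: "0 < real T"
    using t by simp
  have "emeasure M {\<omega>\<in>space M. real T < run_potential lam t \<omega>} \<le>
      emeasure M {\<omega>\<in>space M. 1 \<le> ennreal (1 / real T) * ennreal (run_potential lam t \<omega>)}"
    using T potential_nonneg[OF lam]
    by (intro emeasure_mono) (auto simp: ennreal_mult'[symmetric] simp flip: ennreal_1)
  also have "\<dots> \<le> ennreal (1 / real T) * (\<integral>\<^sup>+\<omega>. ennreal (run_potential lam t \<omega>) * indicator (space M) \<omega> \<partial>M)"
    by (intro nn_integral_Markov_inequality) measurable
  also have "(\<integral>\<^sup>+\<omega>. ennreal (run_potential lam t \<omega>) * indicator (space M) \<omega> \<partial>M) = (\<integral>\<^sup>+\<omega>. run_potential lam t \<omega> \<partial>M)"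
    by (intro nn_integral_cong) simp
  also have "\<dots> \<le> 1"
    by (rule nn_integral_potential_le_1[OF lam t])
  finally show ?thesis
    using T by (simp add: emeasure_eq_measure mult_left_mono)
qed

end

subsection \<open>Unsaturated arms\<close>

lemma matrix_norm_nonneg: "posdef A \<Longrightarrow> 0 \<le> matrix_norm A v"
  by (simp add: matrix_norm_def posdef_nonneg)

lemma matrix_norm_pos: "posdef A \<Longrightarrow> v \<noteq> 0 \<Longrightarrow> 0 < matrix_norm A v"
  by (simp add: matrix_norm_def posdef_def)

lemma continuous_on_matrix_norm: "continuous_on S (matrix_norm A)"
  unfolding matrix_norm_def[abs_def]
  by (intro continuous_intros linear_continuous_on matrix_vector_mul_bounded_linear)

text \<open>In the next definitions \<open>r\<close> stands for the mean reward of an optimal arm.\<close>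

definition unsaturated :: "real ^ 'n \<Rightarrow> real \<Rightarrow> real \<Rightarrow> real ^ 'n ^ 'n \<Rightarrow> real ^ 'n \<Rightarrow> bool" where
  "unsaturated \<theta> r \<beta> A v \<longleftrightarrow> r - v \<bullet> \<theta> < \<beta> * matrix_norm A v"

definition min_width :: "real ^ 'n \<Rightarrow> real \<Rightarrow> real \<Rightarrow> (real ^ 'n) set \<Rightarrow> real ^ 'n ^ 'n \<Rightarrow> real" where
  "min_width \<theta> r \<beta> K A = (INF v\<in>K. if unsaturated \<theta> r \<beta> A v then min 1 (matrix_norm A v) else 1)"

lemma width_nonneg:
  "posdef A \<Longrightarrow> 0 \<le> (if unsaturated \<theta> r \<beta> A v then min 1 (matrix_norm A v) else 1)"
  by (simp add: matrix_norm_nonneg)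

lemma min_width_lower:
  assumes "posdef A" "v \<in> K"
  shows "min_width \<theta> r \<beta> K A \<le> (if unsaturated \<theta> r \<beta> A v then min 1 (matrix_norm A v) else 1)"
  unfolding min_width_def
  by (rule cINF_lower[OF bdd_belowI2[of _ 0] assms(2)]) (rule width_nonneg[OF assms(1)])

lemma min_width_bounds:
  assumes "posdef A" "K \<noteq> {}"
  shows "0 \<le> min_width \<theta> r \<beta> K A" "min_width \<theta> r \<beta> K A \<le> 1"
proof -
  show "0 \<le> min_width \<theta> r \<beta> K A"
    unfolding min_width_def by (rule cINF_greatest[OF assms(2)]) (rule width_nonneg[OF assms(1)])
  obtain v where "v \<in> K"
    using assms(2) by auto
  then show "min_width \<theta> r \<beta> K A \<le> 1"
    using min_width_lower[OF assms(1), of v K \<theta> r \<beta>] by (simp split: if_splits)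
qed

text \<open>A dense subset suffices because being unsaturated is an open condition.\<close>

lemma min_width_le_closure:
  assumes A: "posdef A" and v: "v \<in> closure K" and unsat: "unsaturated \<theta> r \<beta> A v"
  shows "min_width \<theta> r \<beta> K A \<le> min 1 (matrix_norm A v)"
proof -
  obtain u where u: "\<And>k. u k \<in> K" "u \<longlonglongrightarrow> v"
    using v unfolding closure_sequential by blast
  have n: "(\<lambda>k. matrix_norm A (u k)) \<longlonglongrightarrow> matrix_norm A v"
    using continuous_on_tendsto_compose[OF continuous_on_matrix_norm u(2), of UNIV A] by simp
  have "(\<lambda>k. \<beta> * matrix_norm A (u k) - (r - u k \<bullet> \<theta>)) \<longlonglongrightarrow> \<beta> * matrix_norm A v - (r - v \<bullet> \<theta>)"
    by (intro tendsto_intros n u(2))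
  then have "\<forall>\<^sub>F k in sequentially. 0 < \<beta> * matrix_norm A (u k) - (r - u k \<bullet> \<theta>)"
    by (rule order_tendstoD) (use unsat in \<open>simp add: unsaturated_def\<close>)
  then have "\<forall>\<^sub>F k in sequentially. min_width \<theta> r \<beta> K A \<le> min 1 (matrix_norm A (u k))"
  proof (rule eventually_mono)
    fix k assume "0 < \<beta> * matrix_norm A (u k) - (r - u k \<bullet> \<theta>)"
    then have "unsaturated \<theta> r \<beta> A (u k)"
      by (simp add: unsaturated_def)
    then show "min_width \<theta> r \<beta> K A \<le> min 1 (matrix_norm A (u k))"
      using min_width_lower[OF A u(1), of \<theta> r \<beta> k] by simp
  qed
  then show ?thesis
    by (intro tendsto_lowerbound[OF tendsto_min[OF tendsto_const n]]) simp_all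
qed

lemma gap_le_min_width:
  fixes \<theta> \<theta>' :: "real ^ 'n"
  assumes A: "posdef A" and K: "K \<noteq> {}" and \<beta>: "1 \<le> c\<^sub>1 + c\<^sub>2"
    and conf: "\<And>u. \<bar>(\<theta>' - \<theta>) \<bullet> u\<bar> \<le> c\<^sub>1 * matrix_norm A u"
    and z: "\<bar>z\<bar> \<le> c\<^sub>2"
    and max: "\<And>u. u \<in> K \<Longrightarrow> \<theta>' \<bullet> u + z * matrix_norm A u \<le> \<theta>' \<bullet> v + z * matrix_norm A v"
    and gap: "r - v \<bullet> \<theta> \<le> 1"
  shows "r - v \<bullet> \<theta> \<le> (c\<^sub>1 + c\<^sub>2) * (2 * min_width \<theta> r (c\<^sub>1 + c\<^sub>2) K A + min 1 (matrix_norm A v))"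
proof -
  let ?\<beta> = "c\<^sub>1 + c\<^sub>2" and ?n = "matrix_norm A"
  have n: "0 \<le> ?n u" for u
    by (rule matrix_norm_nonneg[OF A])
  have index: "\<bar>\<theta>' \<bullet> u + z * ?n u - u \<bullet> \<theta>\<bar> \<le> ?\<beta> * ?n u" for u
  proof -
    have "\<bar>z * ?n u\<bar> \<le> c\<^sub>2 * ?n u"
      using z n[of u] by (simp add: abs_mult mult_right_mono)
    moreover have "\<theta>' \<bullet> u - u \<bullet> \<theta> = (\<theta>' - \<theta>) \<bullet> u"
      by (simp only: inner_diff_left inner_commute[of u \<theta>])
    ultimately show ?thesis
      using conf[of u] unfolding distrib_right by linarith
  qed
  have "((r - v \<bullet> \<theta>) / ?\<beta> - min 1 (?n v)) / 2 \<le> min_width \<theta> r ?\<beta> K A"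
    unfolding min_width_def
  proof (rule cINF_greatest[OF K])
    fix u assume u: "u \<in> K"
    let ?w = "if unsaturated \<theta> r ?\<beta> A u then min 1 (?n u) else 1"
    have "r - v \<bullet> \<theta> \<le> ?\<beta> * (2 * ?w + min 1 (?n v))"
    proof (cases "unsaturated \<theta> r ?\<beta> A u \<and> ?n u \<le> 1 \<and> ?n v \<le> 1")
      case True
      then have "r - u \<bullet> \<theta> \<le> ?\<beta> * ?n u"
        by (simp add: unsaturated_def)
      then have "r - v \<bullet> \<theta> \<le> ?\<beta> * ?n u + ?\<beta> * ?n u + ?\<beta> * ?n v"
        using max[OF u] index[of u] index[of v] by linarith
      moreover have "?w = ?n u" "min 1 (?n v) = ?n v"
        using True by simp_all
      ultimately show ?thesis
        by (simp only: distrib_left)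
    next
      case False
      then have "1 \<le> 2 * ?w + min 1 (?n v)"
        using n[of u] n[of v] by (auto simp: min_def)
      then have "1 * 1 \<le> ?\<beta> * (2 * ?w + min 1 (?n v))"
        using \<beta> by (intro mult_mono) auto
      then show ?thesis
        using gap by simp
    qed
    then have "(r - v \<bullet> \<theta>) / ?\<beta> \<le> 2 * ?w + min 1 (?n v)"
      using \<beta> by (simp add: pos_divide_le_eq mult.commute)
    then show "((r - v \<bullet> \<theta>) / ?\<beta> - min 1 (?n v)) / 2 \<le> ?w"
      by simp
  qed
  then have "(r - v \<bullet> \<theta>) / ?\<beta> \<le> 2 * min_width \<theta> r ?\<beta> K A + min 1 (?n v)"
    by simp
  then show ?thesis
    using \<beta> by (simp add: pos_divide_le_eq mult.commute)
qed

lemma argmax_unsaturated: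
  fixes \<theta> \<theta>' :: "real ^ 'n"
  assumes A: "posdef A" and conf: "\<And>u. \<bar>(\<theta>' - \<theta>) \<bullet> u\<bar> \<le> c\<^sub>1 * matrix_norm A u"
    and z: "c\<^sub>1 < z" "\<bar>z\<bar> \<le> c\<^sub>2"
    and u: "u \<noteq> 0" and max: "\<theta>' \<bullet> u + z * matrix_norm A u \<le> \<theta>' \<bullet> v + z * matrix_norm A v"
  shows "unsaturated \<theta> (u \<bullet> \<theta>) (c\<^sub>1 + c\<^sub>2) A v"
proof -
  let ?n = "matrix_norm A"
  have eq: "\<theta>' \<bullet> w - w \<bullet> \<theta> = (\<theta>' - \<theta>) \<bullet> w" for w
    by (simp only: inner_diff_left inner_commute[of w \<theta>])
  have "c\<^sub>1 * ?n u < z * ?n u"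
    using z matrix_norm_pos[OF A u] by simp
  moreover have "z * ?n v \<le> c\<^sub>2 * ?n v"
    using z matrix_norm_nonneg[OF A, of v] by (intro mult_right_mono) auto
  ultimately show ?thesis
    using max conf[of u] conf[of v] eq[of u] eq[of v] unfolding unsaturated_def distrib_right by linarith
qed

lemma radius_ge_half:
  fixes d lam :: real
  assumes d: "2 \<le> d" and lam: "0 < lam" and T: "1 \<le> T"
  shows "1 / 2 \<le> sqrt lam + 1 / 2 * sqrt (d * ln (real T + (real T)\<^sup>2 / (d * lam)))"
proof -
  let ?y = "real T + (real T)\<^sup>2 / (d * lam)"
  have T1: "1 \<le> real T" "1 \<le> (real T)\<^sup>2"
    using T by (simp_all add: one_le_power)
  have "1 / (d * lam) \<le> (real T)\<^sup>2 / (d * lam)"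
    using T1 d lam by (intro divide_right_mono) auto
  then have y: "1 + 1 / (d * lam) \<le> ?y"
    using T1 by linarith
  show ?thesis
  proof (cases "1 / 4 \<le> lam")
    case True
    have "sqrt (1 / 4) \<le> sqrt lam"
      using True by simp
    then have "1 / 2 \<le> sqrt lam"
      by (simp add: real_sqrt_divide)
    moreover have "0 \<le> sqrt (d * ln ?y)"
    proof -
      have "0 \<le> 1 / (d * lam)"
        using d lam by simp
      then have "1 \<le> ?y"
        using y by linarith
      then show ?thesis
        using d by simp
    qed
    ultimately show ?thesis by linarith
  next
    case False
    have "d * lam \<le> d / 4"
      using False d by simp
    then have "1 / (d / 4) \<le> 1 / (d * lam)"
      using d lam by (intro divide_left_mono) auto
    then have y4: "1 + 4 / d \<le> ?y"
      using y by simp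
    have pos: "0 < 1 + 4 / d"
      using d by (intro add_pos_nonneg) auto
    have "ln (1 / (1 + 4 / d)) \<le> 1 / (1 + 4 / d) - 1"
      using pos by (intro ln_le_minus_one) simp
    then have "1 - 1 / (1 + 4 / d) \<le> ln (1 + 4 / d)"
      using pos by (simp add: ln_div)
    moreover have "1 / (1 + 4 / d) = d / (d + 4)"
      using d by (simp add: field_simps)
    moreover have "1 / d \<le> 1 - d / (d + 4)"
    proof -
      have "1 - d / (d + 4) = 4 / (d + 4)"
        using d by (simp add: diff_divide_eq_iff)
      moreover have "1 * (d + 4) \<le> 4 * d"
        using d by simp
      then have "1 / d \<le> 4 / (d + 4)"
        using d by (simp add: frac_le_eq divide_le_eq)
      ultimately show ?thesis by simp
    qed
    moreover have "ln (1 + 4 / d) \<le> ln ?y"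
      using y4 pos by simp
    ultimately have "1 / d \<le> ln ?y" by linarith
    then have "1 \<le> d * ln ?y"
      using d by (simp add: pos_divide_le_eq mult.commute)
    then have "1 \<le> sqrt (d * ln ?y)" by simp
    moreover have "0 \<le> sqrt lam"
      using lam by simp
    ultimately show ?thesis by linarith
  qed
qed

subsection \<open>The regret of a round\<close>

context rand_ucb_run
begin

lemma borel_measurable_sampling: "t \<in> {1..T} \<Longrightarrow> Z t \<in> borel_measurable M"
  using copies_independent by (simp add: indep_vars_def)

lemma prob_sampling:
  assumes t: "t \<in> {1..T}" and B: "B \<in> sets borel"
  shows "prob {\<omega>\<in>space M. Z t \<omega> \<in> B} = \<P>(z in N. Z\<^sub>0 z \<in> B)"
proof -
  have "measure (distr M borel (Z t)) B = measure (distr N borel Z\<^sub>0) B"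
    by (simp add: copies_distribution[OF t])
  then show ?thesis
    using measure_distr[OF borel_measurable_sampling[OF t] B] measure_distr[OF sampling_measurable B]
    by (simp add: vimage_def Int_def conj_commute)
qed

lemma expectation_history_sampling:
  assumes t: "t \<in> {1..T}" and \<phi>: "\<phi> \<in> borel_measurable (history_space \<A> t)"
    and bound: "\<And>\<omega>. \<omega> \<in> space M \<Longrightarrow> \<bar>\<phi> (history I Y t \<omega>)\<bar> \<le> 1" and B: "B \<in> sets borel"
  shows "(\<integral>\<omega>. indicator B (Z t \<omega>) * \<phi> (history I Y t \<omega>) \<partial>M) =
    prob {\<omega>\<in>space M. Z t \<omega> \<in> B} * (\<integral>\<omega>. \<phi> (history I Y t \<omega>) \<partial>M)"
proof -
  note Z = borel_measurable_sampling[OF t] and hist = measurable_history[OF t]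
  let ?ZA = "vimage_algebra (space M) (Z t) borel"
    and ?HA = "vimage_algebra (space M) (history I Y t) (history_space \<A> t)"
  have mB: "(\<lambda>\<omega>. indicator B (Z t \<omega>) :: real) \<in> borel_measurable M"
    by (rule measurable_compose[OF Z borel_measurable_indicator[OF B]])
  have m\<phi>: "(\<lambda>\<omega>. \<phi> (history I Y t \<omega>)) \<in> borel_measurable M"
    by (rule measurable_compose[OF hist \<phi>])
  have "(\<lambda>\<omega>. indicator B (Z t \<omega>) :: real) \<in> borel_measurable ?ZA"
    by (rule measurable_compose[OF measurable_vimage_algebra1 borel_measurable_indicator[OF B]]) simp
  then have sub1: "sets (vimage_algebra (space M) (\<lambda>\<omega>. indicator B (Z t \<omega>) :: real) borel) \<subseteq> sets ?ZA"
    by (intro sets_image_in_sets) simp_all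
  have "(\<lambda>\<omega>. \<phi> (history I Y t \<omega>)) \<in> borel_measurable ?HA"
    using measurable_space[OF hist] by (intro measurable_compose[OF measurable_vimage_algebra1 \<phi>]) auto
  then have sub2: "sets (vimage_algebra (space M) (\<lambda>\<omega>. \<phi> (history I Y t \<omega>)) borel) \<subseteq> sets ?HA"
    by (intro sets_image_in_sets) simp_all
  have indep: "indep_var borel (\<lambda>\<omega>. indicator B (Z t \<omega>) :: real) borel (\<lambda>\<omega>. \<phi> (history I Y t \<omega>))"
    unfolding indep_var_eq sets_vimage_algebra[symmetric]
  proof (intro conjI mB m\<phi>)
    show "indep_set (sets (vimage_algebra (space M) (\<lambda>\<omega>. indicator B (Z t \<omega>) :: real) borel))
        (sets (vimage_algebra (space M) (\<lambda>\<omega>. \<phi> (history I Y t \<omega>)) borel))"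
      using copies_fresh[OF t] sub1 sub2 unfolding indep_sets2_eq
      by (meson order_trans subsetD)
  qed
  have "integrable M (\<lambda>\<omega>. indicator B (Z t \<omega>) :: real)"
    by (rule integrable_const_bound[where B = 1, OF _ mB]) (simp add: indicator_def)
  moreover have "integrable M (\<lambda>\<omega>. \<phi> (history I Y t \<omega>))"
    by (rule integrable_const_bound[where B = 1, OF _ measurable_compose[OF hist \<phi>]]) (simp add: bound)
  ultimately have "(\<integral>\<omega>. indicator B (Z t \<omega>) * \<phi> (history I Y t \<omega>) \<partial>M) =
      (\<integral>\<omega>. indicator B (Z t \<omega>) \<partial>M) * (\<integral>\<omega>. \<phi> (history I Y t \<omega>) \<partial>M)"
    by (rule indep_var_lebesgue_integral[OF indep])
  also have "(\<integral>\<omega>. indicator B (Z t \<omega>) \<partial>M) = (\<integral>\<omega>. indicator {\<omega>\<in>space M. Z t \<omega> \<in> B} \<omega> \<partial>M)"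
    by (intro Bochner_Integration.integral_cong) (auto simp: indicator_def)
  also have "\<dots> = prob {\<omega>\<in>space M. Z t \<omega> \<in> B}"
    by (subst Bochner_Integration.integral_indicator) (auto intro!: arg_cong[of _ _ prob])
  finally show ?thesis .
qed

abbreviation run_inverse_design :: "nat \<Rightarrow> 'w \<Rightarrow> real ^ 'd ^ 'd" where
  "run_inverse_design t \<omega> \<equiv> matrix_inv (design_matrix lam (\<lambda>s. x (I s \<omega>)) t)"

definition run_width :: "nat \<Rightarrow> 'w \<Rightarrow> real" where
  "run_width t \<omega> = min 1 (matrix_norm (run_inverse_design t \<omega>) (x (I t \<omega>)))"

lemma posdef_run_inverse_design: "0 < lam \<Longrightarrow> posdef (run_inverse_design t \<omega>)"
  by (intro posdef_matrix_inv posdef_design_matrix)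

lemma run_width_bounds: "0 < lam \<Longrightarrow> 0 \<le> run_width t \<omega>" "run_width t \<omega> \<le> 1"
  by (simp_all add: run_width_def matrix_norm_nonneg posdef_run_inverse_design)

lemma borel_measurable_run_width:
  assumes lam: "0 < lam" and t: "t \<in> {1..T}"
  shows "run_width t \<in> borel_measurable M"
proof -
  have V: "(\<lambda>\<omega>. design_matrix lam (\<lambda>s. x (I s \<omega>)) t $ i $ j) \<in> borel_measurable M" for i j
    by (rule borel_measurable_design_matrix[OF borel_measurable_feature]) (use t in auto)
  note x = borel_measurable_feature[OF t]
  note [measurable] = borel_measurable_matrix_inv_form[OF V posdef_design_matrix[OF lam] x x]
  show ?thesis
    unfolding run_width_def[abs_def] matrix_norm_def by measurable
qed

lemma integrable_run_width: "0 < lam \<Longrightarrow> t \<in> {1..T} \<Longrightarrow> integrable M (run_width t)"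
  by (rule integrable_const_bound[where B = 1, OF _ borel_measurable_run_width])
    (simp_all add: run_width_bounds)

lemma sum_run_width_le:
  assumes lam: "0 < lam" and \<omega>: "\<omega> \<in> space M"
  shows "(\<Sum>t=1..T. run_width t \<omega>) \<le>
    sqrt (2 * real CARD('d) * ln (1 + real T / (real CARD('d) * lam)) * real T)"
proof -
  let ?X = "\<lambda>s. x (I s \<omega>)"
  have sq: "(run_width t \<omega>)\<^sup>2 = min 1 (?X t \<bullet> (run_inverse_design t \<omega> *v ?X t))" for t
  proof -
    have "(min 1 (sqrt a))\<^sup>2 = min 1 a" if "0 \<le> a" for a :: real
      using that by (auto simp: min_def)
    then show ?thesis
      unfolding run_width_def matrix_norm_def using posdef_nonneg[OF posdef_run_inverse_design[OF lam]] by blast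
  qed
  have X: "norm (?X s) \<le> 1" if "s \<in> {1..<Suc T}" for s
    using that by (intro features_norm measurable_space[OF pull_measurable \<omega>]) auto
  have "(\<Sum>t=1..T. (run_width t \<omega>)\<^sup>2) \<le> 2 * ln (det (design_matrix lam ?X (Suc T)) / lam ^ CARD('d))"
    unfolding sq by (rule sum_min_one_le_ln_det[OF lam])
  also have "\<dots> \<le> 2 * (real CARD('d) * ln (1 + (real (Suc T) - 1) / (real CARD('d) * lam)))"
    by (intro mult_left_mono ln_det_design_matrix_le[OF lam _ X]) simp_all
  finally have "(\<Sum>t=1..T. (run_width t \<omega>)\<^sup>2) \<le> 2 * real CARD('d) * ln (1 + real T / (real CARD('d) * lam))"
    by simp
  then have "(\<Sum>t=1..T. (run_width t \<omega>)\<^sup>2) * real T \<le>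
      2 * real CARD('d) * ln (1 + real T / (real CARD('d) * lam)) * real T"
    by (rule mult_right_mono) simp
  moreover have "(\<Sum>t=1..T. run_width t \<omega>)\<^sup>2 \<le> (\<Sum>t=1..T. (run_width t \<omega>)\<^sup>2) * real T"
    using sum_squared_le_sum_of_squares[of "\<lambda>t. run_width t \<omega>" "{1..T}"] by simp
  ultimately show ?thesis
    by (intro real_le_rsqrt) linarith
qed

lemma expectation_gap_le:
  fixes c\<^sub>1 c\<^sub>2 p\<^sub>1 p\<^sub>2 :: real
  assumes n: "1 < CARD('d)" and lam: "0 < lam" and t: "t \<in> {1..T}" and opt: "optimal_arm \<A> x \<theta> a\<^sub>1"
    and c1: "c\<^sub>1 = sqrt lam + 1 / 2 * sqrt (real CARD('d) * ln (real T + (real T)\<^sup>2 / (real CARD('d) * lam)))"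
    and c2: "c\<^sub>1 < c\<^sub>2"
    and p1: "p\<^sub>1 = \<P>(z in N. c\<^sub>1 < Z\<^sub>0 z)" and p2: "p\<^sub>2 = \<P>(z in N. c\<^sub>2 < \<bar>Z\<^sub>0 z\<bar>)" and p: "p\<^sub>2 < p\<^sub>1"
    and x1: "x a\<^sub>1 \<noteq> 0"
  shows "(\<integral>\<omega>. (x a\<^sub>1 - x (I t \<omega>)) \<bullet> \<theta> \<partial>M) \<le>
    (c\<^sub>1 + c\<^sub>2) * (1 + 2 / (p\<^sub>1 - p\<^sub>2)) * (\<integral>\<omega>. run_width t \<omega> \<partial>M) + p\<^sub>2 + 1 / real T"
proof -
  let ?\<beta> = "c\<^sub>1 + c\<^sub>2" and ?r = "x a\<^sub>1 \<bullet> \<theta>" and ?n = "real CARD('d)"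
  have a1: "a\<^sub>1 \<in> space \<A>"
    using opt by (simp add: optimal_arm_def is_arg_max_def)
  have best: "x a \<bullet> \<theta> \<le> ?r" if "a \<in> space \<A>" for a
    using opt that by (auto simp: optimal_arm_def is_arg_max_def not_less)
  have "1 / 2 \<le> c\<^sub>1"
    unfolding c1 using n t lam by (intro radius_ge_half) auto
  then have \<beta>: "1 \<le> ?\<beta>"
    using c2 by simp
  obtain K where K: "countable K" "K \<subseteq> x ` space \<A>" "x ` space \<A> \<subseteq> closure K"
    by (rule separable)
  have K0: "K \<noteq> {}"
    using K(3) a1 by auto
  define good where "good \<omega> \<longleftrightarrow> run_potential lam t \<omega> \<le> real T" for \<omega>
  define m where "m \<omega> = min_width \<theta> ?r ?\<beta> K (run_inverse_design t \<omega>)" for \<omega>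
  define \<phi> where "\<phi> h = (if potential lam \<theta> (\<lambda>s. x (fst (h s))) (\<lambda>s. snd (h s)) t \<le> real T
      then min_width \<theta> ?r ?\<beta> K (matrix_inv (design_matrix lam (\<lambda>s. x (fst (h s))) t)) else 0)"
    for h :: "nat \<Rightarrow> 'a \<times> real"
  define mg where "mg \<omega> = (if good \<omega> then m \<omega> else 0)" for \<omega>
  have m: "0 \<le> m \<omega>" "m \<omega> \<le> 1" for \<omega>
    unfolding m_def by (rule min_width_bounds[OF posdef_run_inverse_design[OF lam] K0])+
  have \<phi>_eq: "\<phi> (history I Y t \<omega>) = mg \<omega>" for \<omega>
  proof -
    have "potential lam \<theta> (\<lambda>s. x (fst (history I Y t \<omega> s))) (\<lambda>s. snd (history I Y t \<omega> s)) t = run_potential lam t \<omega>"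
      by (rule potential_cong) (simp add: history_apply)
    moreover have "design_matrix lam (\<lambda>s. x (fst (history I Y t \<omega> s))) t = design_matrix lam (\<lambda>s. x (I s \<omega>)) t"
      by (rule design_matrix_cong) (simp add: history_apply)
    ultimately show ?thesis
      by (simp only: \<phi>_def mg_def m_def good_def)
  qed
  have \<phi>: "\<phi> \<in> borel_measurable (history_space \<A> t)"
  proof -
    let ?A = "\<lambda>h :: nat \<Rightarrow> 'a \<times> real. matrix_inv (design_matrix lam (\<lambda>s. x (fst (h s))) t)"
    have [measurable]: "(\<lambda>h. matrix_norm (?A h) v) \<in> borel_measurable (history_space \<A> t)" for v
    proof -
      note [measurable] = borel_measurable_matrix_inv_form[OF
          borel_measurable_design_matrix[OF borel_measurable_history_feature(1)]
          posdef_design_matrix[OF lam] borel_measurable_const[of v] borel_measurable_const[of v]]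
      show ?thesis
        unfolding matrix_norm_def by measurable
    qed
    have "(\<lambda>h. if unsaturated \<theta> ?r ?\<beta> (?A h) v then min 1 (matrix_norm (?A h) v) else 1)
        \<in> borel_measurable (history_space \<A> t)" for v
      unfolding unsaturated_def by measurable
    then have [measurable]: "(\<lambda>h. min_width \<theta> ?r ?\<beta> K (?A h)) \<in> borel_measurable (history_space \<A> t)"
      unfolding min_width_def by (rule borel_measurable_cINF_real[OF K(1)])
    note [measurable] = borel_measurable_potential[OF lam borel_measurable_history_feature]
    show ?thesis
      unfolding \<phi>_def[abs_def] by measurable
  qed
  have mg_meas: "mg \<in> borel_measurable M"
    using measurable_compose[OF measurable_history[OF t] \<phi>] by (simp add: \<phi>_eq)
  have mg: "0 \<le> mg \<omega>" "mg \<omega> \<le> 1" for \<omega>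
    using m[of \<omega>] by (simp_all add: mg_def)
  have mg_int: "integrable M mg"
    by (rule integrable_const_bound[where B = 1, OF _ mg_meas]) (simp add: mg)
  note Z[measurable] = borel_measurable_sampling[OF t]
  have pot[measurable]: "run_potential lam t \<in> borel_measurable M"
    by (rule borel_measurable_potential[OF lam borel_measurable_feature reward_measurable]) (use t in auto)
  note w = run_width_bounds(1)[OF lam] run_width_bounds(2)
  define B where "B = {z. c\<^sub>1 < z \<and> \<bar>z\<bar> \<le> c\<^sub>2}"
  have B[measurable]: "B \<in> sets borel"
    unfolding B_def by measurable
  have conf: "\<bar>(ridge_estimate lam (\<lambda>s. x (I s \<omega>)) (\<lambda>s. Y s \<omega>) t - \<theta>) \<bullet> v\<bar>
      \<le> c\<^sub>1 * matrix_norm (run_inverse_design t \<omega>) v" if "\<omega> \<in> space M" "good \<omega>" for \<omega> v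
    unfolding c1
  proof (rule ridge_estimate_confidence[OF n lam t _ parameter_norm])
    fix s assume "s \<in> {1..<t}"
    then show "norm (x (I s \<omega>)) \<le> 1"
      using t by (intro features_norm measurable_space[OF pull_measurable that(1)]) auto
  qed (use that(2) in \<open>simp add: good_def\<close>)
  have max: "AE \<omega> in M. \<forall>u\<in>x ` space \<A>.
      ridge_estimate lam (\<lambda>s. x (I s \<omega>)) (\<lambda>s. Y s \<omega>) t \<bullet> u + Z t \<omega> * matrix_norm (run_inverse_design t \<omega>) u
      \<le> ridge_estimate lam (\<lambda>s. x (I s \<omega>)) (\<lambda>s. Y s \<omega>) t \<bullet> x (I t \<omega>)
        + Z t \<omega> * matrix_norm (run_inverse_design t \<omega>) (x (I t \<omega>))"
    using pull_rule[OF t]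
    by (rule eventually_mono) (auto simp: is_arg_max_def rand_ucb_index_def not_less)
  have gap: "0 \<le> ?r - x (I t \<omega>) \<bullet> \<theta>" "?r - x (I t \<omega>) \<bullet> \<theta> \<le> 1" if "\<omega> \<in> space M" for \<omega>
  proof -
    have a: "I t \<omega> \<in> space \<A>"
      by (rule measurable_space[OF pull_measurable[OF t] that])
    show "0 \<le> ?r - x (I t \<omega>) \<bullet> \<theta>" "?r - x (I t \<omega>) \<bullet> \<theta> \<le> 1"
      using best[OF a] mean_bounds[OF a] mean_bounds[OF a1] by linarith+
  qed
  have "AE \<omega> in M. indicator B (Z t \<omega>) * mg \<omega> \<le> run_width t \<omega>"
    using max AE_space
  proof eventually_elim
    case (elim \<omega>)
    show ?case
    proof (cases "Z t \<omega> \<in> B \<and> good \<omega>")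
      case True
      have a: "I t \<omega> \<in> space \<A>"
        by (rule measurable_space[OF pull_measurable[OF t] elim(2)])
      have "unsaturated \<theta> ?r ?\<beta> (run_inverse_design t \<omega>) (x (I t \<omega>))"
      proof (rule argmax_unsaturated[OF posdef_run_inverse_design[OF lam] conf[OF elim(2)] _ _ x1])
        show "c\<^sub>1 < Z t \<omega>" "\<bar>Z t \<omega>\<bar> \<le> c\<^sub>2" "good \<omega>"
          using True by (simp_all add: B_def)
      qed (use elim(1) a1 in blast)
      then have "m \<omega> \<le> run_width t \<omega>"
        unfolding m_def run_width_def using a K(3)
        by (intro min_width_le_closure[OF posdef_run_inverse_design[OF lam]]) auto
      then show ?thesis
        using True by (simp add: mg_def)
    next
      case False
      then show ?thesis
        using w(1)[of t \<omega>] by (auto simp: mg_def)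
    qed
  qed
  then have "(\<integral>\<omega>. indicator B (Z t \<omega>) * mg \<omega> \<partial>M) \<le> (\<integral>\<omega>. run_width t \<omega> \<partial>M)"
  proof (rule integral_mono_AE[rotated 2])
    show "integrable M (\<lambda>\<omega>. indicator B (Z t \<omega>) * mg \<omega>)"
    proof (rule integrable_const_bound[where B = 1])
      show "AE \<omega> in M. norm (indicator B (Z t \<omega>) * mg \<omega>) \<le> 1"
        using mg by (intro AE_I2) (simp add: indicator_def)
      show "(\<lambda>\<omega>. indicator B (Z t \<omega>) * mg \<omega>) \<in> borel_measurable M"
        by (intro borel_measurable_times mg_meas measurable_compose[OF Z borel_measurable_indicator[OF B]])
    qed
  qed (rule integrable_run_width[OF lam t])
  also have "(\<integral>\<omega>. indicator B (Z t \<omega>) * mg \<omega> \<partial>M) = prob {\<omega>\<in>space M. Z t \<omega> \<in> B} * (\<integral>\<omega>. mg \<omega> \<partial>M)"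
    using expectation_history_sampling[OF t \<phi> _ B] mg by (simp add: \<phi>_eq)
  finally have mg_le: "prob {\<omega>\<in>space M. Z t \<omega> \<in> B} * (\<integral>\<omega>. mg \<omega> \<partial>M) \<le> (\<integral>\<omega>. run_width t \<omega> \<partial>M)" .
  have P1: "prob {\<omega>\<in>space M. c\<^sub>1 < Z t \<omega>} = p\<^sub>1"
    using prob_sampling[OF t, of "{c\<^sub>1<..}"] by (simp add: p1)
  have P2: "prob {\<omega>\<in>space M. c\<^sub>2 < \<bar>Z t \<omega>\<bar>} = p\<^sub>2"
    using prob_sampling[OF t, of "{z. c\<^sub>2 < \<bar>z\<bar>}"] by (simp add: p2)
  have "prob {\<omega>\<in>space M. c\<^sub>1 < Z t \<omega>} \<le> prob ({\<omega>\<in>space M. Z t \<omega> \<in> B} \<union> {\<omega>\<in>space M. c\<^sub>2 < \<bar>Z t \<omega>\<bar>})"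
    by (rule finite_measure_mono) (auto simp: B_def)
  also have "\<dots> \<le> prob {\<omega>\<in>space M. Z t \<omega> \<in> B} + prob {\<omega>\<in>space M. c\<^sub>2 < \<bar>Z t \<omega>\<bar>}"
    by (rule measure_Un_le) measurable
  finally have "p\<^sub>1 - p\<^sub>2 \<le> prob {\<omega>\<in>space M. Z t \<omega> \<in> B}"
    using P1 P2 by simp
  then have "(p\<^sub>1 - p\<^sub>2) * (\<integral>\<omega>. mg \<omega> \<partial>M) \<le> prob {\<omega>\<in>space M. Z t \<omega> \<in> B} * (\<integral>\<omega>. mg \<omega> \<partial>M)"
    by (rule mult_right_mono) (simp add: mg integral_nonneg_AE)
  with mg_le have "(p\<^sub>1 - p\<^sub>2) * (\<integral>\<omega>. mg \<omega> \<partial>M) \<le> (\<integral>\<omega>. run_width t \<omega> \<partial>M)" by linarith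
  then have mg_le': "(\<integral>\<omega>. mg \<omega> \<partial>M) \<le> (\<integral>\<omega>. run_width t \<omega> \<partial>M) / (p\<^sub>1 - p\<^sub>2)"
    using p by (simp add: pos_le_divide_eq mult.commute)
  let ?bad = "{\<omega>\<in>space M. real T < run_potential lam t \<omega>}" and ?far = "{\<omega>\<in>space M. c\<^sub>2 < \<bar>Z t \<omega>\<bar>}"
  have meas[measurable]: "?bad \<in> events" "?far \<in> events" by measurable
  have "AE \<omega> in M. ?r - x (I t \<omega>) \<bullet> \<theta> \<le>
      ?\<beta> * (2 * mg \<omega> + run_width t \<omega>) + indicator ?far \<omega> + indicator ?bad \<omega>"
    using max AE_space
  proof eventually_elim
    case (elim \<omega>)
    have pos: "0 \<le> ?\<beta> * (2 * mg \<omega> + run_width t \<omega>)"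
      using \<beta> mg(1)[of \<omega>] w(1)[of t \<omega>] by (intro mult_nonneg_nonneg) simp_all
    show ?case
    proof (cases "good \<omega> \<and> \<bar>Z t \<omega>\<bar> \<le> c\<^sub>2")
      case True
      have "?r - x (I t \<omega>) \<bullet> \<theta> \<le> ?\<beta> * (2 * m \<omega> + run_width t \<omega>)"
        unfolding m_def run_width_def
        by (rule gap_le_min_width[OF posdef_run_inverse_design[OF lam] K0 \<beta> conf[OF elim(2)]])
          (use True elim K(2) gap[OF elim(2)] in blast)+
      then show ?thesis
        using True by (simp add: mg_def good_def)
    next
      case False
      then have "1 \<le> indicator ?far \<omega> + (indicator ?bad \<omega> :: real)"
        using elim(2) by (auto simp: good_def indicator_def)
      then show ?thesis
        using gap(2)[OF elim(2)] pos by linarith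
    qed
  qed
  then have "(\<integral>\<omega>. ?r - x (I t \<omega>) \<bullet> \<theta> \<partial>M) \<le>
      (\<integral>\<omega>. ?\<beta> * (2 * mg \<omega> + run_width t \<omega>) + indicator ?far \<omega> + indicator ?bad \<omega> \<partial>M)"
  proof (rule integral_mono_AE[rotated 2])
    note [measurable] = borel_measurable_feature[OF t]
    show "integrable M (\<lambda>\<omega>. ?r - x (I t \<omega>) \<bullet> \<theta>)"
      by (rule integrable_const_bound[where B = 1]) (use gap in auto)
  qed (simp add: mg_int integrable_run_width[OF lam t] less_top[symmetric])
  also have "\<dots> = ?\<beta> * (2 * (\<integral>\<omega>. mg \<omega> \<partial>M) + (\<integral>\<omega>. run_width t \<omega> \<partial>M)) + prob ?far + prob ?bad"
  proof -
    have "integrable M (indicator ?far :: _ \<Rightarrow> real)" "integrable M (indicator ?bad :: _ \<Rightarrow> real)"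
      by (simp_all add: less_top[symmetric])
    moreover have "?far \<inter> space M = ?far" "?bad \<inter> space M = ?bad"
      by auto
    ultimately show ?thesis
      using mg_int integrable_run_width[OF lam t] by simp
  qed
  also have "\<dots> \<le> ?\<beta> * (2 * ((\<integral>\<omega>. run_width t \<omega> \<partial>M) / (p\<^sub>1 - p\<^sub>2)) + (\<integral>\<omega>. run_width t \<omega> \<partial>M)) + p\<^sub>2 + 1 / real T"
    using mg_le' \<beta> P2 prob_potential_gt_le[OF lam t] by (intro add_mono mult_left_mono) auto
  also have "?\<beta> * (2 * ((\<integral>\<omega>. run_width t \<omega> \<partial>M) / (p\<^sub>1 - p\<^sub>2)) + (\<integral>\<omega>. run_width t \<omega> \<partial>M)) =
      ?\<beta> * (1 + 2 / (p\<^sub>1 - p\<^sub>2)) * (\<integral>\<omega>. run_width t \<omega> \<partial>M)"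
    by (simp add: algebra_simps)
  finally show ?thesis
    by (simp add: inner_diff_left)
qed

end

theorem theorem3:
  fixes M :: "'w measure"
    and \<A> :: "'a measure"
    and x :: "'a \<Rightarrow> real ^ 'd"
    and \<theta> :: "real ^ 'd"
    and \<nu> :: "'a \<Rightarrow> real measure"
    and T :: nat
    and I :: "nat \<Rightarrow> 'w \<Rightarrow> 'a"
    and Y :: "nat \<Rightarrow> 'w \<Rightarrow> real"
    and lam :: real
    and N :: "'z measure"
    and Z\<^sub>0 :: "'z \<Rightarrow> real"
    and Z :: "nat \<Rightarrow> 'w \<Rightarrow> real"
    and a\<^sub>1 :: 'a
    and d c\<^sub>1 c\<^sub>2 c\<^sub>3 :: real
  assumes "CARD('d) > 1"
    and "T \<ge> 1"
    and "lam > 0"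
    and "rand_ucb_run M \<A> x \<theta> \<nu> T I Y lam N Z\<^sub>0 Z"
    and "optimal_arm \<A> x \<theta> a\<^sub>1"
    and "d = real CARD('d)"
    and "c\<^sub>1 = sqrt lam + 1 / 2 * sqrt (d * ln (real T + (real T)\<^sup>2 / (d * lam)))"
    and "c\<^sub>3 = 2 * d * ln (1 + real T / (d * lam))"
    and "c\<^sub>2 > c\<^sub>1"
    and "\<P>(z in N. Z\<^sub>0 z > c\<^sub>1) > \<P>(z in N. \<bar>Z\<^sub>0 z\<bar> > c\<^sub>2)"
  shows "regret M x \<theta> a\<^sub>1 I T \<le>
    (c\<^sub>1 + c\<^sub>2) * (1 + 2 / (\<P>(z in N. Z\<^sub>0 z > c\<^sub>1) - \<P>(z in N. \<bar>Z\<^sub>0 z\<bar> > c\<^sub>2))) * sqrt (c\<^sub>3 * real T)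
      + real T * \<P>(z in N. \<bar>Z\<^sub>0 z\<bar> > c\<^sub>2) + 1"
proof -
  interpret rand_ucb_run M \<A> x \<theta> \<nu> T I Y lam N Z\<^sub>0 Z
    by (rule assms(4))
  define p\<^sub>1 where "p\<^sub>1 = \<P>(z in N. Z\<^sub>0 z > c\<^sub>1)"
  define p\<^sub>2 where "p\<^sub>2 = \<P>(z in N. \<bar>Z\<^sub>0 z\<bar> > c\<^sub>2)"
  define C where "C = (c\<^sub>1 + c\<^sub>2) * (1 + 2 / (p\<^sub>1 - p\<^sub>2))"
  have p: "p\<^sub>2 < p\<^sub>1" "0 \<le> p\<^sub>2"
    using assms(10) by (simp_all add: p\<^sub>1_def p\<^sub>2_def)
  have "1 / 2 \<le> c\<^sub>1"
    unfolding assms(7) using assms(1,2,3,6) by (intro radius_ge_half) auto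
  then have C: "0 \<le> C"
    unfolding C_def using assms(9) p by (intro mult_nonneg_nonneg add_nonneg_nonneg) auto
  have "regret M x \<theta> a\<^sub>1 I T \<le> C * sqrt (c\<^sub>3 * real T) + real T * p\<^sub>2 + 1"
  proof (cases "x a\<^sub>1 = 0")
    case True
    have "x (I t \<omega>) \<bullet> \<theta> = 0" if "t \<in> {1..T}" "\<omega> \<in> space M" for t \<omega>
    proof -
      have a: "I t \<omega> \<in> space \<A>"
        by (rule measurable_space[OF pull_measurable[OF that(1)] that(2)])
      then have "x (I t \<omega>) \<bullet> \<theta> \<le> x a\<^sub>1 \<bullet> \<theta>"
        using assms(5) by (auto simp: optimal_arm_def is_arg_max_def not_less)
      then show ?thesis
        using mean_bounds(1)[OF a] True by simp
    qed
    then have "(\<integral>\<omega>. (x a\<^sub>1 - x (I t \<omega>)) \<bullet> \<theta> \<partial>M) = (\<integral>\<omega>. 0 \<partial>M)" if "t \<in> {1..T}" for t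
      using that True by (intro Bochner_Integration.integral_cong) simp_all
    then have "regret M x \<theta> a\<^sub>1 I T = 0"
      by (simp add: regret_def)
    moreover have "0 \<le> c\<^sub>3"
      using assms(3,6) by (simp add: assms(8))
    then have "0 \<le> C * sqrt (c\<^sub>3 * real T)"
      using C by simp
    ultimately show ?thesis
      using p(2) by simp
  next
    case False
    have "regret M x \<theta> a\<^sub>1 I T \<le> (\<Sum>t=1..T. C * (\<integral>\<omega>. run_width t \<omega> \<partial>M) + p\<^sub>2 + 1 / real T)"
      unfolding regret_def C_def
    proof (rule sum_mono)
      fix t assume t: "t \<in> {1..T}"
      show "(\<integral>\<omega>. (x a\<^sub>1 - x (I t \<omega>)) \<bullet> \<theta> \<partial>M) \<le>
          (c\<^sub>1 + c\<^sub>2) * (1 + 2 / (p\<^sub>1 - p\<^sub>2)) * (\<integral>\<omega>. run_width t \<omega> \<partial>M) + p\<^sub>2 + 1 / real T"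
        by (rule expectation_gap_le[OF assms(1,3) t assms(5) assms(7)[unfolded assms(6)] assms(9)
              p\<^sub>1_def p\<^sub>2_def p(1) False])
    qed
    also have "\<dots> = C * (\<Sum>t=1..T. \<integral>\<omega>. run_width t \<omega> \<partial>M) + real T * p\<^sub>2 + 1"
      using assms(2) by (simp add: sum.distrib sum_distrib_left)
    also have "(\<Sum>t=1..T. \<integral>\<omega>. run_width t \<omega> \<partial>M) = (\<integral>\<omega>. (\<Sum>t=1..T. run_width t \<omega>) \<partial>M)"
      by (rule Bochner_Integration.integral_sum[symmetric, OF integrable_run_width[OF assms(3)]])
    also have "\<dots> \<le> sqrt (c\<^sub>3 * real T)"
    proof (rule integral_le_const)
      show "integrable M (\<lambda>\<omega>. \<Sum>t=1..T. run_width t \<omega>)"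
        by (intro Bochner_Integration.integrable_sum integrable_run_width[OF assms(3)])
      show "AE \<omega> in M. (\<Sum>t=1..T. run_width t \<omega>) \<le> sqrt (c\<^sub>3 * real T)"
        unfolding assms(8) assms(6) by (rule AE_I2) (rule sum_run_width_le[OF assms(3)])
    qed
    finally show ?thesis
      using C by (simp add: mult_left_mono)
  qed
  then show ?thesis
    by (simp only: C_def p\<^sub>1_def p\<^sub>2_def)
qed

end
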